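(* Let $n\geq 2$ and let $F$ be a non-empty linear forest on $m$ vertices. Then $$R(P_n,K_1\vee F)=\begin{cases}2n-1, & 2\leq m\leq n;\\ t(n,m), & m\geq 2n.\end{cases}$$
   Context: All graphs are finite and simple. $P_n$ denotes the path on $n$ vertices. A linear forest is a forest each of whose components is a path; it is non-empty if it has at least one edge. $K_1\vee F$ denotes the join of a single vertex with $F$ (the graph obtained by adding a new vertex adjacent to every vertex of $F$). For graphs $G_1,G_2$, the Ramsey number $R(G_1,G_2)$ is the least integer $r$ such that for every graph $G$ on $r$ vertices, either $G$ contains a subgraph isomorphic to $G_1$ or the complement $\overline{G}$ contains a subgraph isomorphic to $G_2$. For integers $n,m\geq 2$, let $\alpha=\frac{m-1}{n-1}$, $\beta=\lceil\alpha\rceil$ and $\gamma=\frac{\beta^2}{\beta+1}$, and define $$t(n,m)=\begin{cases}(n-1)\beta+1, & \alpha\leq\gamma;\\ \lfloor (m-1)/\beta\rfloor+m, & \alpha>\gamma.\end{cases}$$ *)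

theory Defs
  imports
    Complex_Main
    "Graph_Theory.Pair_Digraph"
    "Graph_Theory.Digraph_Component"
    "Graph_Theory.Digraph_Isomorphism"
begin

text \<open>
  A finite simple graph is a loop-free symmetric digraph \<open>G\<close> with \<open>pair_graph G\<close>: an edge
  \<open>uv\<close> is the pair of arcs \<open>(u, v)\<close> and \<open>(v, u)\<close>.
\<close>

definition path_graph :: "nat \<Rightarrow> nat pair_pre_digraph" where
  "path_graph n =
    \<lparr> pverts = {..<n},
      parcs = {(i, j). i < n \<and> j < n \<and> (j = Suc i \<or> i = Suc j)} \<rparr>"

definition complement_graph :: "'a pair_pre_digraph \<Rightarrow> 'a pair_pre_digraph" where
  "complement_graph G =
    \<lparr> pverts = pverts G,
      parcs = {(u, v). u \<in> pverts G \<and> v \<in> pverts G \<and> u \<noteq> v \<and> (u, v) \<notin> parcs G} \<rparr>"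

text \<open>The join of a single vertex, here \<open>None\<close>, with a graph.\<close>

definition K1_join :: "'a pair_pre_digraph \<Rightarrow> 'a option pair_pre_digraph" where
  "K1_join F =
    \<lparr> pverts = insert None (Some ` pverts F),
      parcs = {(Some u, Some v) | u v. (u, v) \<in> parcs F}
            \<union> {(None, Some v) | v. v \<in> pverts F}
            \<union> {(Some v, None) | v. v \<in> pverts F} \<rparr>"

text \<open>
  The library's \<open>forest\<close> forbids every directed cycle, so a symmetric digraph with an edge
  \<open>uv\<close> never satisfies it, because of the cycle \<open>u, v, u\<close>. The cycles of an undirected simple
  graph are the directed cycles of length at least 3.
\<close>

definition undirected_forest :: "'a pair_pre_digraph \<Rightarrow> bool" where
  "undirected_forest F \<longleftrightarrow>
    pair_graph F \<and> \<not> (\<exists>p. pre_digraph.cycle (with_proj F) p \<and> 3 \<le> length p)"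

text \<open>For a symmetric digraph, the strongly connected components are the usual components.\<close>

definition linear_forest :: "'a pair_pre_digraph \<Rightarrow> bool" where
  "linear_forest F \<longleftrightarrow>
    undirected_forest F \<and>
    (\<forall>C \<in> pre_digraph.sccs (with_proj F). \<exists>k. digraph_iso C (with_proj (path_graph k)))"

definition contains_copy :: "'a pair_pre_digraph \<Rightarrow> 'b pair_pre_digraph \<Rightarrow> bool" where
  "contains_copy G H \<longleftrightarrow> (\<exists>H'. subgraph H' (with_proj G) \<and> digraph_iso (with_proj H) H')"

text \<open>
  Both alternatives below are invariant under isomorphism of \<open>G\<close>, so graphs with vertices in
  \<open>nat\<close> represent all finite graphs.
\<close>

definition ramsey_number :: "'a pair_pre_digraph \<Rightarrow> 'b pair_pre_digraph \<Rightarrow> nat" where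
  "ramsey_number G1 G2 =
    (LEAST r. \<forall>G :: nat pair_pre_digraph. pair_graph G \<and> card (pverts G) = r \<longrightarrow>
       contains_copy G G1 \<or> contains_copy (complement_graph G) G2)"

definition t_alpha :: "nat \<Rightarrow> nat \<Rightarrow> real" where
  "t_alpha n m = (real m - 1) / (real n - 1)"

definition t_beta :: "nat \<Rightarrow> nat \<Rightarrow> nat" where
  "t_beta n m = nat \<lceil>t_alpha n m\<rceil>"

definition t_gamma :: "nat \<Rightarrow> nat \<Rightarrow> real" where
  "t_gamma n m = (real (t_beta n m))\<^sup>2 / (real (t_beta n m) + 1)"

definition t_value :: "nat \<Rightarrow> nat \<Rightarrow> nat" where
  "t_value n m =
    (if t_alpha n m \<le> t_gamma n m
     then (n - 1) * t_beta n m + 1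
     else nat \<lfloor>(real m - 1) / real (t_beta n m)\<rfloor> + m)"

lemma pair_graph_path_graph: "pair_graph (path_graph n)"
proof -
  have "parcs (path_graph n) \<subseteq> {..<n} \<times> {..<n}"
    by (auto simp: path_graph_def)
  then have "finite (parcs (path_graph n))"
    by (rule finite_subset) simp
  then show ?thesis
    by unfold_locales (auto simp: path_graph_def symmetric_def intro: symI)
qed

lemma pair_graph_complement_graph:
  assumes "pair_graph G"
  shows "pair_graph (complement_graph G)"
proof -
  interpret pair_graph G by fact
  have "parcs (complement_graph G) \<subseteq> pverts G \<times> pverts G"
    by (auto simp: complement_graph_def)
  then have "finite (parcs (complement_graph G))"
    by (rule finite_subset) (simp add: pair_finite_verts)
  moreover have "sym (parcs G)"
    using pair_sym_arcs by (simp add: symmetric_def)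
  ultimately show ?thesis
    by unfold_locales
      (auto simp: complement_graph_def symmetric_def pair_finite_verts intro!: symI dest: symD)
qed

lemma pair_graph_K1_join:
  assumes "pair_graph F"
  shows "pair_graph (K1_join F)"
proof -
  interpret pair_graph F by fact
  let ?V = "insert None (Some ` pverts F)"
  have "parcs (K1_join F) \<subseteq> ?V \<times> ?V"
    by (auto simp: K1_join_def dest: wellformed')
  then have "finite (parcs (K1_join F))"
    by (rule finite_subset) (simp add: pair_finite_verts)
  moreover have "sym (parcs F)"
    using pair_sym_arcs by (simp add: symmetric_def)
  ultimately show ?thesis
    by unfold_locales
      (auto simp: K1_join_def symmetric_def pair_finite_verts
            intro!: symI dest: symD wellformed' pair_no_loops)
qed

end

theory Submission
  imports Defs
begin

text \<open>
  The lower bounds come from disjoint unions of cliques of nearly equal orders. For the upper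
  bounds let \<open>G\<close> have no path on \<open>n\<close> vertices, \<open>N = t(n,m)\<close> vertices, and put \<open>k = n div 2\<close>.

  Let \<open>m \<ge> 2n\<close> and let \<open>B\<close> be the set of vertices with fewer than \<open>n\<close> non-neighbours. If some
  \<open>v \<notin> B\<close> has \<open>|N(v) \<union> B| < k\<close>, then delete \<open>v\<close>, \<open>N(v)\<close> and \<open>B\<close>: at least \<open>N - k \<ge> m\<close> vertices remain,
  each with at least \<open>n - k\<close> non-neighbours among them, and a closure argument in the style
  of Ore and Bondy--Chvatal gives a Hamiltonian path of the complement there.
  Otherwise every vertex outside \<open>B\<close> has at least \<open>k - |B|\<close> neighbours outside \<open>B\<close>. If
  \<open>B \<noteq> {}\<close>, some path contains all of \<open>B\<close> (or \<open>k\<close> vertices of it) without using edges inside \<open>B\<close>,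
  and a longest such path has at least \<open>2k + 1 \<ge> n\<close> vertices, by rotations. If \<open>B = {}\<close>, the same rotations
  show that all components have fewer than \<open>n\<close> vertices; counting components gives a vertex with
  at least \<open>m\<close> non-neighbours, whose complement graph again has a Hamiltonian path.

  Let \<open>m \<le> n\<close> and \<open>N = 2n - 1\<close>. A vertex of degree below \<open>k\<close> has at least \<open>n + k - 1\<close> non-neighbours, and the
  theorem of Gerencser and Gyarfas applies to them. Otherwise there are three components, and one
  vertex of the first is joined in the complement to a path alternating between the other two.
\<close>

section \<open>Paths in a symmetric relation\<close>

definition path_in :: "('a \<Rightarrow> 'a \<Rightarrow> bool) \<Rightarrow> 'a set \<Rightarrow> 'a list \<Rightarrow> bool" where
  "path_in E V xs \<longleftrightarrow> distinct xs \<and> set xs \<subseteq> V \<and> successively E xs"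

lemma successively_rev_sym:
  assumes "\<And>x y. E x y \<Longrightarrow> E y x"
  shows "successively E (rev xs) \<longleftrightarrow> successively E xs"
proof -
  have "(\<lambda>x y. E y x) = E" using assms by blast
  then show ?thesis by (metis successively_rev)
qed

lemma path_in_rev:
  assumes "\<And>x y. E x y \<Longrightarrow> E y x"
  shows "path_in E V (rev xs) \<longleftrightarrow> path_in E V xs"
proof -
  have "successively E (rev xs) \<longleftrightarrow> successively E xs"
    by (rule successively_rev_sym) (rule assms)
  then show ?thesis unfolding path_in_def by (metis distinct_rev set_rev)
qed

lemma path_in_take:
  assumes "path_in E V xs"
  shows "path_in E V (take n xs)"
proof -
  have "successively E (take n xs @ drop n xs)" using assms by (simp add: path_in_def)
  then show ?thesis
    using assms set_take_subset[of n xs]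
    by (auto simp: path_in_def successively_append_iff simp del: append_take_drop_id)
qed

lemma path_in_mono:
  assumes "path_in E V xs" "\<And>x y. E x y \<Longrightarrow> E' x y" "V \<subseteq> V'"
  shows "path_in E' V' xs"
  using assms by (auto simp: path_in_def intro: successively_mono)

lemma path_in_length_less:
  assumes "\<not> (\<exists>xs. path_in E V xs \<and> length xs = n)" "path_in E V xs"
  shows "length xs < n"
proof (rule ccontr)
  assume "\<not> length xs < n"
  then have "length (take n xs) = n" by simp
  then show False using assms path_in_take[of E V xs n] by blast
qed

lemma split_at_nth:
  assumes "Suc i < length xs"
  obtains as x y bs where "xs = as @ x # y # bs" "xs ! i = x" "xs ! Suc i = y"
  using assms by (metis Cons_nth_drop_Suc Suc_lessD id_take_nth_drop)

lemma successively_appendI: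
  assumes "successively E xs" "successively E ys" "last xs = x" "hd ys = y" "E x y"
  shows "successively E (xs @ ys)"
  using assms by (auto simp: successively_append_iff)

text \<open>When the ends of a path are adjacent, the path closes to a cycle; cutting it in front of
  \<open>x\<close> makes \<open>x\<close> the first vertex, to which \<open>w\<close> can be
  attached.\<close>

lemma successively_cycle_open:
  assumes "successively E xs" "E (last xs) (hd xs)" "x \<in> set xs" "E w x"
  shows "\<exists>ys. successively E (w # ys) \<and> set ys = set xs \<and> length ys = length xs \<and>
    (distinct xs \<longrightarrow> distinct ys)"
proof -
  from assms(3) obtain as bs where xs: "xs = as @ x # bs" by (meson split_list)
  show ?thesis
    by (rule exI[of _ "x # bs @ as"])
      (use assms in \<open>auto simp: xs successively_append_iff successively_Cons hd_append split: if_splits\<close>)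
qed

text \<open>This is Posa's rotation: an edge from the first vertex to \<open>b\<close> lets the
  segment before \<open>b\<close> be reversed, so that \<open>a\<close> becomes the first vertex
  while the last one stays.\<close>

lemma successively_flip_prefix:
  assumes sym: "\<And>x y. E x y \<Longrightarrow> E y x"
    and "successively E (as @ a # b # bs)" "E (hd (as @ [a])) b"
  shows "successively E (a # rev as @ b # bs)"
proof -
  have "successively E (as @ [a])"
    using assms(2) by (auto simp: successively_append_iff successively_Cons)
  then have "successively E (rev (as @ [a]))"
    using successively_rev_sym[of E] sym by metis
  moreover have "successively E (b # bs)"
    using assms(2) by (auto simp: successively_append_iff successively_Cons)
  moreover have "last (rev (as @ [a])) = hd (as @ [a])"
    by (metis append_is_Nil_conv last_rev list.discI)
  ultimately have "successively E (rev (as @ [a]) @ b # bs)"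
    using assms(3) by (subst successively_append_iff) auto
  then show ?thesis by simp
qed

text \<open>Entries that are never consecutive fill at most every other place, which is half the
  length rounded up; a first entry without \<open>P\<close> removes the rounding.\<close>

lemma no_two_consecutive_filter:
  assumes "successively (\<lambda>x y. \<not> (P x \<and> P y)) xs"
  shows "2 * length (filter P xs) \<le> length xs + 1 \<and>
    (xs \<noteq> [] \<and> \<not> P (hd xs) \<longrightarrow> 2 * length (filter P xs) \<le> length xs)"
  using assms
proof (induction xs)
  case (Cons x xs)
  show ?case
  proof (cases xs)
    case (Cons y ys)
    then show ?thesis using Cons.IH Cons.prems by (auto simp: successively_Cons)
  qed simp
qed simp

lemma no_two_consecutive_filter_ends:
  assumes "successively (\<lambda>x y. \<not> (P x \<and> P y)) xs" "xs \<noteq> []"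
  shows "\<not> P (last xs) \<Longrightarrow> 2 * length (filter P xs) \<le> length xs"
    and "\<not> P (hd xs) \<Longrightarrow> \<not> P (last xs) \<Longrightarrow> 2 * length (filter P xs) < length xs"
proof -
  have last: "2 * length (filter P ys) \<le> length ys"
    if "successively (\<lambda>x y. \<not> (P x \<and> P y)) ys" "ys \<noteq> []" "\<not> P (last ys)" for ys
  proof -
    have "successively (\<lambda>x y. \<not> (P x \<and> P y)) (rev ys)"
      using that(1) by (subst successively_rev_sym) auto
    from no_two_consecutive_filter[OF this] that show ?thesis
      by (simp add: hd_rev rev_filter[symmetric])
  qed
  show "\<not> P (last xs) \<Longrightarrow> 2 * length (filter P xs) \<le> length xs"
    using last assms by blast
  assume ends: "\<not> P (hd xs)" "\<not> P (last xs)"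
  obtain x ys where xs: "xs = x # ys" using assms(2) by (cases xs) auto
  have "2 * length (filter P ys) \<le> length ys"
    using last[of ys] assms ends by (cases ys) (auto simp: xs)
  then show "2 * length (filter P xs) < length xs" using ends by (simp add: xs)
qed

section \<open>Counting positions on a longest path\<close>

lemma card_nth_Collect:
  assumes "distinct xs"
  shows "card {i. i < length xs \<and> xs ! i \<in> S} = card (set xs \<inter> S)"
proof -
  have "inj_on ((!) xs) {i. i < length xs \<and> xs ! i \<in> S}"
    using assms by (auto simp: inj_on_def nth_eq_iff_index_eq)
  moreover have "(!) xs ` {i. i < length xs \<and> xs ! i \<in> S} = set xs \<inter> S"
    by (auto simp: in_set_conv_nth)
  ultimately show ?thesis by (metis card_image)
qed

text \<open>This is the position count of Ore-type arguments. In the applications \<open>I\<close>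
  and \<open>J\<close> are the positions of the neighbours of two vertices, such as the last and the
  first of a path, and \<open>X\<close> holds positions that both must avoid.\<close>

lemma card_shifted_disjoint:
  fixes I J X :: "nat set"
  assumes "Suc ` I \<inter> J = {}" "Suc ` I \<subseteq> {1..<l} - X" "J \<subseteq> {1..<l} - X" "X \<subseteq> {1..<l}"
  shows "card I + card J + card X \<le> l - 1"
proof -
  have fin: "finite (Suc ` I)" "finite J" "finite X"
    using assms(2-4) by (meson finite_Diff finite_atLeastLessThan finite_subset)+
  have "card I + card J = card (Suc ` I \<union> J)"
    using fin assms(1) by (simp add: card_Un_disjoint card_image)
  also have "\<dots> + card X = card (Suc ` I \<union> J \<union> X)"
    using fin assms by (subst card_Un_disjoint) auto
  also have "\<dots> \<le> card {1..<l}" using assms by (intro card_mono) auto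
  finally show ?thesis by simp
qed

text \<open>
  A longest path \<open>T\<close> through \<open>B\<close> ends outside \<open>B\<close>. If the last vertex is joined to some \<open>T ! i\<close> and
  the first one to \<open>T ! (i + 1)\<close>, a cycle on \<open>T\<close> could be opened up and extended; if one of these two
  vertices lies in \<open>B\<close> already one of the two edges leads to a longer path. So the two
  neighbourhoods, the second one shifted, avoid each other and the \<open>2 |B|\<close> positions of \<open>B\<close>
  and of the successors of \<open>B\<close>.
\<close>

lemma long_path_through:
  fixes E :: "'a \<Rightarrow> 'a \<Rightarrow> bool"
  assumes fin: "finite V" and sym: "\<And>x y. E x y \<Longrightarrow> E y x" and irr: "\<And>x. \<not> E x x"
    and BV: "B \<subseteq> V" and indep: "\<And>x y. x \<in> B \<Longrightarrow> y \<in> B \<Longrightarrow> \<not> E x y"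
    and deg: "\<And>v. v \<in> V - B \<Longrightarrow> d \<le> card {w \<in> V - B. E v w}"
    and n: "n \<le> 2 * (d + card B) + 1"
    and start: "path_in E V xs0" "B \<subseteq> set xs0" "xs0 \<noteq> []"
    and extB: "\<And>u xs. u \<in> B \<Longrightarrow> path_in E V xs \<Longrightarrow> length xs < n \<Longrightarrow> \<exists>w \<in> V - set xs. E u w"
    and ext: "\<And>xs. B = {} \<Longrightarrow> path_in E V xs \<Longrightarrow> xs \<noteq> [] \<Longrightarrow> length xs < n \<Longrightarrow>
      \<exists>x \<in> set xs. \<exists>w \<in> V - set xs. E x w"
  shows "\<exists>xs. path_in E V xs \<and> length xs = n"
proof (rule ccontr)
  assume no: "\<not> ?thesis"
  define good where "good xs \<longleftrightarrow> path_in E V xs \<and> B \<subseteq> set xs \<and> xs \<noteq> []" for xs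
  have short: "length xs < n" if "path_in E V xs" for xs
    using path_in_length_less[OF no that] .
  obtain xs where good: "good xs" and max: "\<And>ys. good ys \<Longrightarrow> length ys \<le> length xs"
    using ex_has_greatest_nat[of good xs0 length n] start short unfolding good_def by blast
  have path: "path_in E V xs" and Bxs: "B \<subseteq> set xs" and ne: "xs \<noteq> []"
    using good by (auto simp: good_def)
  have dist: "distinct xs" and sub: "set xs \<subseteq> V" and succ: "successively E xs"
    using path by (auto simp: path_in_def)
  have no_longer: False
    if "successively E (w # ys)" "set ys = set xs" "distinct ys" "length ys = length xs"
      "w \<in> V" "w \<notin> set xs" for w ys
  proof -
    have "good (w # ys)" using that sub Bxs by (auto simp: good_def path_in_def)
    from max[OF this] that(4) show False by simp
  qed
  \<comment> \<open>By maximality no rearrangement of the same vertices can begin in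
    \<open>B\<close>: \<open>extB\<close> would supply a new vertex in front.\<close>
  have no_B_start: "hd ys \<notin> B"
    if "successively E ys" "set ys = set xs" "distinct ys" "length ys = length xs" for ys
  proof
    assume "hd ys \<in> B"
    moreover have "path_in E V ys" using that sub by (auto simp: path_in_def)
    ultimately obtain w where "w \<in> V - set ys" "E (hd ys) w" using extB short by blast
    then show False using no_longer[of w ys] that sym by (auto simp: successively_Cons)
  qed
  have rev_succ: "successively E (rev ys)" if "successively E ys" for ys
    using that successively_rev_sym[of E] sym by metis
  have hdB: "hd xs \<notin> B" using no_B_start[of xs] succ dist by simp
  have lastB: "last xs \<notin> B"
    using no_B_start[of "rev xs"] rev_succ[OF succ] dist by (simp add: hd_rev)
  have no_cycle: False
    if "successively E ys" "set ys = set xs" "distinct ys" "length ys = length xs"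
      "E (last ys) (hd ys)" for ys
  proof -
    \<comment> \<open>An edge leaving the path comes from \<open>ext\<close> if \<open>B\<close> is
      empty, and otherwise from any vertex of \<open>B\<close>, since all of them lie on the
      path.\<close>
    have "\<exists>x \<in> set xs. \<exists>w \<in> V - set xs. E x w"
    proof (cases "B = {}")
      case True
      then show ?thesis using ext path ne short by blast
    next
      case False
      then show ?thesis using extB path Bxs short by blast
    qed
    then obtain x w where x: "x \<in> set xs" and w: "w \<in> V" "w \<notin> set xs" "E w x" using sym by blast
    have "x \<in> set ys" using x that(2) by simp
    from successively_cycle_open[OF that(1) that(5) this w(3)] obtain zs where
      "successively E (w # zs)" "set zs = set ys" "length zs = length ys" "distinct ys \<longrightarrow> distinct zs"
      by blast
    then show False using no_longer[of w zs] w that by auto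
  qed
  define N where "N v = {w \<in> V - B. E v w}" for v
  have Nsub: "N v \<subseteq> set xs" if "v = hd xs \<or> v = last xs" for v
  proof
    fix w assume w: "w \<in> N v"
    show "w \<in> set xs"
    proof (rule ccontr)
      assume "w \<notin> set xs"
      moreover have "successively E (w # xs) \<or> successively E (w # rev xs)"
        using that w succ rev_succ[OF succ] sym by (auto simp: successively_Cons N_def hd_rev)
      ultimately show False
        using no_longer[of w xs] no_longer[of w "rev xs"] w dist by (auto simp: N_def)
    qed
  qed
  define l where "l = length xs"
  define I where "I = {i. i < l \<and> xs ! i \<in> N (last xs)}"
  define J where "J = {i. i < l \<and> xs ! i \<in> N (hd xs)}"
  define K where "K = {i. i < l \<and> xs ! i \<in> B}"
  have l: "l > 0" using ne by (simp add: l_def)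
  have hd: "hd xs = xs ! 0" and last: "last xs = xs ! (l - 1)"
    using ne by (simp_all add: hd_conv_nth last_conv_nth l_def)
  have deg_le: "d \<le> card (N v)" if "v = hd xs \<or> v = last xs" for v
  proof -
    have "v \<in> V - B" using that hdB lastB sub ne hd_in_set last_in_set by blast
    then show ?thesis unfolding N_def by (rule deg)
  qed
  have cardI: "d \<le> card I" and cardJ: "d \<le> card J" and cardK: "card K = card B"
    using card_nth_Collect[OF dist] deg_le Nsub Bxs
    by (simp_all add: I_def J_def K_def l_def Int_absorb1)
  have pos: "i \<noteq> 0 \<and> Suc i < l" if "i \<in> K" for i
  proof -
    have "i \<noteq> 0" using that hdB hd by (cases i) (auto simp: K_def)
    moreover have "i \<noteq> l - 1" using that lastB last by (auto simp: K_def)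
    ultimately show ?thesis using that by (auto simp: K_def)
  qed
  have consec: "E (xs ! i) (xs ! Suc i)" if "Suc i < l" for i
    using succ that by (auto simp: successively_conv_nth l_def)
  have rot1: "\<not> E (hd xs) (xs ! Suc i)" if "i \<in> K" for i
  proof
    assume E: "E (hd xs) (xs ! Suc i)"
    have "Suc i < length xs" using pos[OF that] by (simp add: l_def)
    then obtain as x y bs where xs: "xs = as @ x # y # bs" and i: "xs ! i = x" "xs ! Suc i = y"
      by (rule split_at_nth)
    have "hd (as @ [x]) = hd xs" by (simp add: xs hd_append)
    then have "successively E (x # rev as @ y # bs)"
      using successively_flip_prefix[of E as x y bs] sym succ E i xs by metis
    moreover have "set (x # rev as @ y # bs) = set xs" "length (x # rev as @ y # bs) = length xs"
      by (auto simp: xs)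
    moreover have "distinct (x # rev as @ y # bs)" using dist by (auto simp: xs)
    ultimately have "x \<notin> B" using no_B_start by fastforce
    then show False using that i by (simp add: K_def)
  qed
  have rot2: "\<not> E (last xs) (xs ! i)" if "Suc i \<in> K" for i
  proof
    assume E: "E (last xs) (xs ! i)"
    have "Suc i < length xs" using that by (auto simp: K_def l_def)
    then obtain as x y bs where xs: "xs = as @ x # y # bs" and i: "xs ! i = x" "xs ! Suc i = y"
      by (rule split_at_nth)
    have "rev xs = rev bs @ y # x # rev as" by (simp add: xs)
    moreover have "hd (rev bs @ [y]) = last xs" by (cases bs rule: rev_cases) (simp_all add: xs)
    ultimately have "successively E (y # rev (rev bs) @ x # rev as)"
      using successively_flip_prefix[of E "rev bs" y x "rev as"] sym rev_succ[OF succ] E i by metis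
    moreover have "set (y # rev (rev bs) @ x # rev as) = set xs"
      "length (y # rev (rev bs) @ x # rev as) = length xs"
      by (auto simp: xs)
    moreover have "distinct (y # rev (rev bs) @ x # rev as)" using dist by (auto simp: xs)
    ultimately have "y \<notin> B" using no_B_start by fastforce
    then show False using that i by (simp add: K_def)
  qed
  have disj: "\<not> (E (last xs) (xs ! i) \<and> E (hd xs) (xs ! Suc i))" if "Suc i < l" for i
  proof
    assume E: "E (last xs) (xs ! i) \<and> E (hd xs) (xs ! Suc i)"
    have "Suc i < length xs" using that by (simp add: l_def)
    then obtain as x y bs where xs: "xs = as @ x # y # bs" and i: "xs ! i = x" "xs ! Suc i = y"
      by (rule split_at_nth)
    have "hd (as @ [x]) = hd xs" by (simp add: xs hd_append)
    then have "successively E (x # rev as @ y # bs)"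
      using successively_flip_prefix[of E as x y bs] sym succ E i xs by metis
    moreover have "last (x # rev as @ y # bs) = last xs" by (simp add: xs)
    moreover have "set (x # rev as @ y # bs) = set xs" "length (x # rev as @ y # bs) = length xs"
      by (auto simp: xs)
    moreover have "distinct (x # rev as @ y # bs)" using dist by (auto simp: xs)
    ultimately show False using no_cycle E i by (metis list.sel(1))
  qed
  have I_lt: "Suc i < l" if "i \<in> I" for i
    using that irr last by (cases "i = l - 1") (auto simp: I_def N_def)
  have J_pos: "0 < i" if "i \<in> J" for i
    using that irr hd by (cases i) (auto simp: J_def N_def)
  have KK: "K \<inter> Suc ` K = {}"
    using consec indep pos by (fastforce simp: K_def)
  \<comment> \<open>\<open>I\<close> and \<open>J\<close> have at least \<open>d\<close> elements
    each, and \<open>K\<close> with its shift takes \<open>2 * card B\<close> further positions, as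
    no two vertices of \<open>B\<close> are consecutive. Position 0 stays free, so the path has at
    least 2(d + |B|) + 1 >= n vertices.\<close>
  have "card I + card J + card (K \<union> Suc ` K) \<le> l - 1"
  proof (rule card_shifted_disjoint)
    show "Suc ` I \<inter> J = {}" using disj I_lt by (auto simp: I_def J_def N_def)
    show "Suc ` I \<subseteq> {1..<l} - (K \<union> Suc ` K)"
      using I_lt rot2 by (auto simp: I_def N_def K_def)
    show "J \<subseteq> {1..<l} - (K \<union> Suc ` K)"
      using J_pos rot1 by (fastforce simp: J_def N_def K_def)
    show "K \<union> Suc ` K \<subseteq> {1..<l}" using pos by force
  qed
  moreover have "card (K \<union> Suc ` K) = 2 * card B"
  proof -
    have "finite K" by (simp add: K_def)
    then show ?thesis using KK cardK by (simp add: card_Un_disjoint card_image)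
  qed
  ultimately have "n \<le> l" using cardI cardJ n l by arith
  then show False using short[OF path] by (simp add: l_def)
qed

section \<open>Alternating paths\<close>

text \<open>Among the alternating paths that begin and end in the independent set \<open>B\<close>,
  take one with the most vertices of \<open>B\<close>. For a vertex \<open>u\<close> of
  \<open>B\<close> off it, the vertex \<open>w\<close> from \<open>step\<close> either links
  \<open>u\<close> to an end or closes the path to a cycle, which is cut open at a neighbour of
  \<open>u\<close>; in each case \<open>u\<close> and \<open>w\<close> are gained.\<close>

lemma alternating_path_through:
  fixes E :: "'a \<Rightarrow> 'a \<Rightarrow> bool"
  assumes fin: "finite B" and ne: "B \<noteq> {}" and BV: "B \<subseteq> V"
    and sym: "\<And>x y. E x y \<Longrightarrow> E y x"
    and indep: "\<And>x y. x \<in> B \<Longrightarrow> y \<in> B \<Longrightarrow> \<not> E x y"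
    and step: "\<And>xs u. path_in E V xs \<Longrightarrow> 2 * card (set xs \<inter> B) = length xs + 1 \<Longrightarrow>
      hd xs \<in> set xs \<inter> B \<Longrightarrow> last xs \<in> set xs \<inter> B \<Longrightarrow> u \<in> B - set xs \<Longrightarrow>
      \<exists>w \<in> V - set xs. E u w \<and> E (hd xs) w \<or> E u w \<and> E (last xs) w \<or>
        E (hd xs) w \<and> E (last xs) w \<and> (\<exists>z \<in> set xs. E u z)"
  shows "\<exists>xs. path_in E V xs \<and> B \<subseteq> set xs \<and> length xs + 1 = 2 * card B \<and> hd xs \<in> B \<and> last xs \<in> B"
proof -
  \<comment> \<open>As \<open>B\<close> is independent, this count is the largest possible; equality
    forces alternation with both ends in \<open>B\<close>.\<close>
  define alt where "alt xs \<longleftrightarrow> path_in E V xs \<and> 2 * card (set xs \<inter> B) = length xs + 1" for xs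
  have ends: "hd xs \<in> set xs \<inter> B \<and> last xs \<in> set xs \<inter> B" if "alt xs" for xs
  proof -
    have *: "successively (\<lambda>x y. \<not> (x \<in> B \<and> y \<in> B)) xs"
      using that indep by (auto simp: alt_def path_in_def elim!: successively_mono)
    have "length (filter (\<lambda>x. x \<in> B) xs) = card (set xs \<inter> B)"
      using that by (simp add: alt_def path_in_def distinct_length_filter Int_commute)
    then have len: "2 * length (filter (\<lambda>x. x \<in> B) xs) = length xs + 1"
      using that by (simp add: alt_def)
    have "xs \<noteq> []" using that by (auto simp: alt_def)
    then show ?thesis
      using no_two_consecutive_filter[OF *] no_two_consecutive_filter_ends(1)[OF *] len by fastforce
  qed
  have grow: "alt (u # ys)"
    if "alt xs" "successively E (u # ys)" "distinct ys" "set ys = insert w (set xs)"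
      "length ys = Suc (length xs)" "u \<in> B - set xs" "w \<in> V - B" for xs ys u w
  proof -
    have "set (u # ys) \<inter> B = insert u (set xs \<inter> B)" using that by auto
    moreover have "card (insert u (set xs \<inter> B)) = Suc (card (set xs \<inter> B))"
      using that by (intro card_insert_disjoint) auto
    ultimately have "card (set (u # ys) \<inter> B) = Suc (card (set xs \<inter> B))" by simp
    then show ?thesis
      using that BV by (auto simp: alt_def path_in_def)
  qed
  obtain b where b: "b \<in> B" using ne by blast
  then have "alt [b]" using BV by (auto simp: alt_def path_in_def)
  moreover have "card (set xs \<inter> B) < Suc (card B)" for xs
    by (meson Int_lower2 card_mono fin le_imp_less_Suc)
  ultimately obtain xs where alt: "alt xs"
    and max: "\<And>ys. alt ys \<Longrightarrow> card (set ys \<inter> B) \<le> card (set xs \<inter> B)"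
    using ex_has_greatest_nat[of alt "[b]" "\<lambda>xs. card (set xs \<inter> B)" "Suc (card B)"] by blast
  have path: "path_in E V xs" and len: "2 * card (set xs \<inter> B) = length xs + 1"
    using alt by (auto simp: alt_def)
  have no_longer: False
    if "successively E (u # ys)" "distinct ys" "set ys = insert w (set xs)"
      "length ys = Suc (length xs)" "u \<in> B - set xs" "w \<in> V - B" for ys u w
  proof -
    have *: "alt (u # ys)" using grow[OF alt that] .
    have "length (u # ys) = length xs + 2" using that by simp
    then have "card (set (u # ys) \<inter> B) = Suc (card (set xs \<inter> B))"
      using * len by (simp add: alt_def)
    then show False using max[OF *] by simp
  qed
  have "B \<subseteq> set xs"
  proof
    fix u assume "u \<in> B"
    show "u \<in> set xs"
    proof (rule ccontr)
      assume "u \<notin> set xs"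
      with \<open>u \<in> B\<close> have u: "u \<in> B - set xs" by blast
      have xs: "successively E xs" "distinct xs" "xs \<noteq> []"
        using path ends[OF alt] by (auto simp: path_in_def)
      then have rxs: "successively E (rev xs)" using successively_rev_sym[of E] sym by metis
      from step[OF path len _ _ u] ends[OF alt] obtain w where w: "w \<in> V - set xs"
        and cases: "E u w \<and> E (hd xs) w \<or> E u w \<and> E (last xs) w \<or>
          E (hd xs) w \<and> E (last xs) w \<and> (\<exists>z \<in> set xs. E u z)" by blast
      have wB: "w \<in> V - B" using w cases indep \<open>u \<in> B\<close> ends[OF alt] by blast
      from cases show False
      proof (elim disjE conjE bexE)
        assume "E u w" "E (hd xs) w"
        then have "successively E (u # w # xs)" using xs sym by (auto simp: successively_Cons)
        from no_longer[OF this _ _ _ u wB] show False using w xs by simp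
      next
        assume "E u w" "E (last xs) w"
        then have "successively E (u # w # rev xs)"
          using rxs xs sym by (auto simp: successively_Cons hd_rev simp del: successively_rev)
        from no_longer[OF this _ _ _ u wB] show False using w xs by simp
      next
        fix z assume *: "E (hd xs) w" "E (last xs) w" and z: "z \<in> set xs" "E u z"
        have "successively E (xs @ [w])"
          using xs * by (auto simp: successively_append_iff)
        moreover have "E (last (xs @ [w])) (hd (xs @ [w]))" using xs * sym by simp
        moreover have "z \<in> set (xs @ [w])" using z by simp
        ultimately obtain ys where "successively E (u # ys)" "set ys = set (xs @ [w])"
          "length ys = length (xs @ [w])" "distinct (xs @ [w]) \<longrightarrow> distinct ys"
          using successively_cycle_open[of E "xs @ [w]" z u] z by blast
        from no_longer[OF this(1) _ _ _ u wB] this show False using w xs by simp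
      qed
    qed
  qed
  moreover from this have "card (set xs \<inter> B) = card B" by (simp add: Int_absorb1)
  ultimately show ?thesis using path len ends[OF alt] by auto
qed

section \<open>Complementary relations and the Ramsey bound for two paths\<close>

definition co :: "('a \<Rightarrow> 'a \<Rightarrow> bool) \<Rightarrow> 'a \<Rightarrow> 'a \<Rightarrow> bool" where
  "co E x y \<longleftrightarrow> x \<noteq> y \<and> \<not> E x y"

lemma co_sym: "(\<And>x y. E x y \<Longrightarrow> E y x) \<Longrightarrow> co E x y \<Longrightarrow> co E y x"
  by (auto simp: co_def)

lemma co_irrefl: "\<not> co E x x"
  by (simp add: co_def)

lemma co_co: "(\<And>x. \<not> E x x) \<Longrightarrow> co (co E) = E"
  by (auto simp: co_def fun_eq_iff)

text \<open>
  Gerencser and Gyarfas: with \<open>Q\<close> a longest \<open>E\<close>-path, every vertex off \<open>Q\<close> is joined in the complement to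
  both ends of \<open>Q\<close> and to one of any two consecutive vertices of \<open>Q\<close>, so that the vertices off \<open>Q\<close>
  can be threaded into a path of the complement which alternates with \<open>Q\<close>.
\<close>

lemma path_or_co_path:
  fixes E :: "'a \<Rightarrow> 'a \<Rightarrow> bool"
  assumes "finite M" "M \<noteq> {}"
    and "\<And>x y. E x y \<Longrightarrow> E y x" "\<And>x. \<not> E x x"
    and "1 \<le> b" "b \<le> a" "a + b div 2 \<le> card M + 1"
  shows "(\<exists>xs. path_in E M xs \<and> length xs = a) \<or> (\<exists>xs. path_in (co E) M xs \<and> length xs = b)"
  using assms
proof (induction "a + b" arbitrary: a b E rule: less_induct)
  case less
  note fin = \<open>finite M\<close> and sym = less.prems(3) and irr = less.prems(4)
  have cosym: "\<And>x y. co E x y \<Longrightarrow> co E y x" using co_sym[of E] sym by blast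
  show ?case
  proof (rule ccontr)
    assume no: "\<not> ?thesis"
    have b2: "2 \<le> b"
    proof (rule ccontr)
      assume "\<not> 2 \<le> b"
      then have "b = 1" using less.prems by simp
      moreover obtain x where "x \<in> M" using less.prems(2) by blast
      then have "path_in (co E) M [x]" by (simp add: path_in_def)
      ultimately show False using no by force
    qed
    \<comment> \<open>Induction lowers the larger of the two lengths; if they are equal,
      \<open>E\<close> and its complement exchange roles, so that the second length is still at most
      the first.\<close>
    have "\<exists>xs. path_in E M xs \<and> length xs = a - 1"
    proof (cases "b < a")
      case True
      have "(\<exists>xs. path_in E M xs \<and> length xs = a - 1) \<or> (\<exists>xs. path_in (co E) M xs \<and> length xs = b)"
        by (rule less.hyps) (use less.prems True b2 in auto)
      then show ?thesis using no by blast
    next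
      case False
      then have ab: "a = b" using less.prems by simp
      have "(\<exists>xs. path_in (co E) M xs \<and> length xs = a) \<or>
        (\<exists>xs. path_in (co (co E)) M xs \<and> length xs = b - 1)"
        by (rule less.hyps) (use less.prems ab b2 cosym co_irrefl[of E] in auto)
      then show ?thesis using no ab co_co[of E] irr by auto
    qed
    then obtain Q where Q: "path_in E M Q" "length Q = a - 1" by blast
    have a2: "2 \<le> a" using b2 less.prems by simp
    have Qne: "Q \<noteq> []" using Q(2) a2 by auto
    define h where "h = b div 2"
    have h1: "1 \<le> h" using b2 by (simp add: h_def)
    have dQ: "distinct Q" and sQ: "set Q \<subseteq> M" and succQ: "successively E Q"
      using Q by (auto simp: path_in_def)
    have "card (M - set Q) = card M - (a - 1)"
      using sQ dQ Q(2) by (simp add: card_Diff_subset distinct_card)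
    then have "h \<le> card (M - set Q)" using less.prems a2 by (simp add: h_def)
    then obtain R where R: "R \<subseteq> M - set Q" "card R = h" "finite R"
      by (meson obtain_subset_with_card_n)
    have not_longer: False if "path_in E M xs" "length xs = a" for xs using no that by blast
    have endsQ: "co E y (hd Q) \<and> co E y (last Q)" if "y \<in> R" for y
    proof -
      have y: "y \<in> M" "y \<notin> set Q" using that R by auto
      have "\<not> E y (hd Q)"
        using not_longer[of "y # Q"] Q y a2 Qne by (auto simp: path_in_def successively_Cons)
      moreover have "\<not> E y (last Q)"
        using not_longer[of "Q @ [y]"] Q y a2 Qne sym
        by (auto simp: path_in_def successively_append_iff)
      ultimately show ?thesis using y Qne by (auto simp: co_def)
    qed
    have consecQ: "co E y (Q ! i) \<or> co E y (Q ! Suc i)" if yR: "y \<in> R" and iQ: "Suc i < length Q" for y i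
    proof (rule ccontr)
      assume *: "\<not> ?thesis"
      have y: "y \<in> M" "y \<notin> set Q" using yR R by auto
      have "Q ! i \<in> set Q" "Q ! Suc i \<in> set Q" using iQ by auto
      then have E: "E y (Q ! i)" "E y (Q ! Suc i)" using * y by (auto simp: co_def)
      obtain as u v bs where Qeq: "Q = as @ u # v # bs" and i: "Q ! i = u" "Q ! Suc i = v"
        using iQ by (rule split_at_nth)
      have "successively E (as @ u # y # v # bs)"
        using succQ E sym i by (auto simp: Qeq successively_append_iff successively_Cons)
      moreover have "distinct (as @ u # y # v # bs)" using dQ y(2) by (auto simp: Qeq)
      moreover have "set (as @ u # y # v # bs) = insert y (set Q)"
        "length (as @ u # y # v # bs) = Suc (length Q)"
        by (auto simp: Qeq)
      ultimately show False
        using not_longer[of "as @ u # y # v # bs"] y sQ Q(2) a2 by (auto simp: path_in_def)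
    qed
    \<comment> \<open>Only complement edges between \<open>R\<close> and \<open>Q\<close> are kept,
      which makes \<open>R\<close> independent for the alternating path.\<close>
    define E' where "E' x y \<longleftrightarrow> co E x y \<and> (x \<in> R \<and> y \<in> set Q \<or> y \<in> R \<and> x \<in> set Q)" for x y
    define V where "V = R \<union> set Q"
    have E'sym: "\<And>x y. E' x y \<Longrightarrow> E' y x" using cosym by (auto simp: E'_def)
    have E'R: "\<not> E' x y" if "x \<in> R" "y \<in> R" for x y using that R by (auto simp: E'_def)
    have nbrs: "a \<le> 2 * card {w \<in> set Q. E' y w}" if "y \<in> R" for y
    proof -
      have "successively (\<lambda>u v. \<not> (\<not> E' y u \<and> \<not> E' y v)) Q"
        using consecQ[OF that] that by (auto simp: successively_conv_nth E'_def)
      moreover have "E' y (hd Q)" "E' y (last Q)" using endsQ[OF that] that Qne by (auto simp: E'_def)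
      ultimately have "2 * length (filter (\<lambda>w. \<not> E' y w) Q) < length Q"
        using no_two_consecutive_filter_ends(2)[of "\<lambda>w. \<not> E' y w" Q] Qne by blast
      moreover have "length (filter (\<lambda>w. \<not> E' y w) Q) + length (filter (E' y) Q) = length Q"
        using sum_length_filter_compl[of "E' y" Q] by simp
      moreover have "length (filter (E' y) Q) = card {w \<in> set Q. E' y w}"
        using dQ by (metis distinct_card distinct_filter set_filter)
      ultimately show ?thesis using Q(2) by linarith
    qed
    have "\<exists>xs. path_in E' V xs \<and> R \<subseteq> set xs \<and> length xs + 1 = 2 * card R \<and> hd xs \<in> R \<and> last xs \<in> R"
    proof (rule alternating_path_through)
      show "finite R" "R \<noteq> {}" "R \<subseteq> V" using R h1 by (auto simp: V_def)
      show "E' x y \<Longrightarrow> E' y x" for x y by (rule E'sym)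
      show "x \<in> R \<Longrightarrow> y \<in> R \<Longrightarrow> \<not> E' x y" for x y by (rule E'R)
    next
      fix xs u
      assume xs: "path_in E' V xs" and len: "2 * card (set xs \<inter> R) = length xs + 1"
        and hd: "hd xs \<in> set xs \<inter> R" and last: "last xs \<in> set xs \<inter> R" and u: "u \<in> R - set xs"
      have "card (insert u (set xs \<inter> R)) \<le> h"
        using u R by (metis Diff_iff Int_lower2 card_mono insert_subset)
      then have j: "card (set xs \<inter> R) < h" using u R(3) by (simp add: card_insert_if)
      have "set xs = (set xs \<inter> R) \<union> (set xs \<inter> set Q)"
        using xs by (auto simp: path_in_def V_def)
      moreover have "(set xs \<inter> R) \<inter> (set xs \<inter> set Q) = {}" using R by auto
      ultimately have "card (set xs) = card (set xs \<inter> R) + card (set xs \<inter> set Q)"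
        by (metis List.finite_set card_Un_disjoint finite_Int)
      then have used: "card (set xs \<inter> set Q) + 2 \<le> h"
        using j len xs by (simp add: path_in_def distinct_card)
      have "\<not> successively (\<lambda>x y. \<not> (x \<notin> set xs \<and> y \<notin> set xs)) Q"
      proof
        assume "successively (\<lambda>x y. \<not> (x \<notin> set xs \<and> y \<notin> set xs)) Q"
        then have "2 * length (filter (\<lambda>x. x \<notin> set xs) Q) \<le> length Q + 1"
          using no_two_consecutive_filter[of "\<lambda>x. x \<notin> set xs" Q] by blast
        moreover have "length (filter (\<lambda>x. x \<notin> set xs) Q) + length (filter (\<lambda>x. x \<in> set xs) Q) = length Q"
          using sum_length_filter_compl[of "\<lambda>x. x \<in> set xs" Q] by simp
        moreover have "length (filter (\<lambda>x. x \<in> set xs) Q) = card (set xs \<inter> set Q)"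
          using dQ by (simp add: distinct_length_filter)
        ultimately have "length Q \<le> 2 * card (set xs \<inter> set Q) + 1" by linarith
        moreover have "2 * h \<le> length Q + 1" using Q(2) less.prems a2 by (simp add: h_def)
        ultimately show False using used by linarith
      qed
      then obtain i where i: "Suc i < length Q" "Q ! i \<notin> set xs" "Q ! Suc i \<notin> set xs"
        by (auto simp: successively_conv_nth)
      have one: "E' y (Q ! i) \<or> E' y (Q ! Suc i)" if "y \<in> R" for y
        using consecQ[OF that i(1)] that i(1) by (auto simp: E'_def)
      have inV: "Q ! i \<in> V - set xs" "Q ! Suc i \<in> V - set xs" using i by (auto simp: V_def)
      have hdQ: "E' y (hd Q)" if "y \<in> R" for y using endsQ[OF that] that Qne by (auto simp: E'_def)
      show "\<exists>w \<in> V - set xs. E' u w \<and> E' (hd xs) w \<or> E' u w \<and> E' (last xs) w \<or>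
        E' (hd xs) w \<and> E' (last xs) w \<and> (\<exists>z \<in> set xs. E' u z)"
      proof (cases "hd Q \<in> set xs")
        case True
        then have "\<exists>z \<in> set xs. E' u z" using hdQ u by blast
        then show ?thesis using one[of u] one[of "hd xs"] one[of "last xs"] inV u hd last by blast
      next
        case False
        then have "hd Q \<in> V - set xs" using Qne by (simp add: V_def)
        then show ?thesis using hdQ u hd by blast
      qed
    qed
    then obtain xs where xs: "path_in E' V xs" "R \<subseteq> set xs" "length xs + 1 = 2 * h"
      "hd xs \<in> R" "last xs \<in> R" using R(2) by blast
    have xsne: "xs \<noteq> []" using xs(3) h1 by auto
    have "set xs = R \<union> (set xs \<inter> set Q)" using xs by (auto simp: path_in_def V_def)
    moreover have "R \<inter> (set xs \<inter> set Q) = {}" using R by auto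
    ultimately have "card (set xs) = h + card (set xs \<inter> set Q)"
      using R by (metis List.finite_set card_Un_disjoint finite_Int)
    then have used: "card (set xs \<inter> set Q) + 1 = h"
      using xs by (simp add: path_in_def distinct_card)
    have free: "\<exists>w \<in> set Q - U. E' y w" if "y \<in> R" "2 * card (U \<inter> set Q) < a" "finite U" for y U
    proof (rule ccontr)
      assume "\<not> ?thesis"
      then have "{w \<in> set Q. E' y w} \<subseteq> U \<inter> set Q" by blast
      then have "card {w \<in> set Q. E' y w} \<le> card (U \<inter> set Q)" using that(3) by (intro card_mono) auto
      then show False using nbrs[OF that(1)] that(2) by linarith
    qed
    have E'co: "path_in (co E) M ys" if "path_in E' V ys" for ys
      by (rule path_in_mono[OF that]) (use R sQ in \<open>auto simp: E'_def V_def\<close>)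
    have ba: "2 * h \<le> a" "b \<le> 2 * h + 1" "b = 2 * h + 1 \<longrightarrow> 2 * h + 1 \<le> a"
      using less.prems by (auto simp: h_def)
    \<comment> \<open>The alternating path has \<open>2 * h - 1\<close> vertices; one more vertex of
      \<open>Q\<close> at the front, and for odd \<open>b\<close> another at the back, bring it to
      \<open>b\<close>.\<close>
    obtain w where w: "w \<in> set Q - set xs" "E' (hd xs) w"
      using free[of "hd xs" "set xs"] xs(4) used ba h1 by auto
    have p1: "path_in E' V (w # xs)"
      using w xs E'sym by (auto simp: path_in_def successively_Cons V_def)
    show False
    proof (cases "b = 2 * h + 1")
      case False
      then have "b = length (w # xs)" using xs(3) ba h1 by (simp add: h_def)
      then show False using no E'co[OF p1] by metis
    next
      case True
      have "insert w (set xs) \<inter> set Q = insert w (set xs \<inter> set Q)" using w by auto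
      then have "card (insert w (set xs) \<inter> set Q) = h" using w used by simp
      then obtain w' where w': "w' \<in> set Q - insert w (set xs)" "E' (last xs) w'"
        using free[of "last xs" "insert w (set xs)"] xs(5) ba True by auto
      have "path_in E' V ((w # xs) @ [w'])"
        using p1 w' xsne by (auto simp: path_in_def successively_append_iff successively_Cons V_def)
      moreover have "length ((w # xs) @ [w']) = b" using xs(3) True h1 by simp
      ultimately show False using no E'co by metis
    qed
  qed
qed

section \<open>Hamiltonian paths of the complement\<close>

text \<open>Deleting the edge \<open>u w\<close> of \<open>F\<close> adds it to the complement, and
  a spanning path that only now exists must use it. Where \<open>u\<close> is adjacent in the
  complement to a vertex of this path and \<open>w\<close> to the next one, the path can be rerouted
  around \<open>u w\<close>. Hence the complement degrees of \<open>u\<close> and \<open>w\<close>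
  sum to at most |X| - 2, as for the Bondy--Chvatal closure.\<close>

lemma spanning_path_co_remove_edge:
  fixes F :: "'a \<Rightarrow> 'a \<Rightarrow> bool"
  assumes fin: "finite X" and sym: "\<And>x y. F x y \<Longrightarrow> F y x" and irr: "\<And>x. \<not> F x x"
    and FX: "\<And>x y. F x y \<Longrightarrow> x \<in> X \<and> y \<in> X"
    and no: "\<not> (\<exists>xs. path_in (co F) X xs \<and> set xs = X)"
    and path: "path_in (co (\<lambda>x y. F x y \<and> {x, y} \<noteq> {u, w})) X xs" "set xs = X"
    and uw: "F u w"
  shows "card X \<le> card {y \<in> X. F u y} + card {y \<in> X. F w y}"
proof -
  let ?F' = "\<lambda>x y. F x y \<and> {x, y} \<noteq> {u, w}"
  have cosym: "\<And>x y. co F x y \<Longrightarrow> co F y x" using co_sym[of F] sym by blast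
  have rev_succ: "successively (co F) (rev ys)" if "successively (co F) ys" for ys
    using that successively_rev_sym[of "co F"] cosym by metis
  have not_path: False if "successively (co F) ys" "distinct ys" "set ys = X" for ys
    using no that by (auto simp: path_in_def)
  have co'sym: "\<And>x y. co ?F' x y \<Longrightarrow> co ?F' y x" using sym by (auto simp: co_def)
  have "\<not> successively (co F) xs" using not_path path by (auto simp: path_in_def)
  then obtain i where i: "Suc i < length xs" "\<not> co F (xs ! i) (xs ! Suc i)"
    by (auto simp: successively_conv_nth)
  moreover have "co ?F' (xs ! i) (xs ! Suc i)"
    using path i by (auto simp: path_in_def successively_conv_nth)
  ultimately have "{xs ! i, xs ! Suc i} = {u, w}" by (auto simp: co_def)
  then have ends: "xs ! i = u \<and> xs ! Suc i = w \<or> xs ! i = w \<and> xs ! Suc i = u"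
    by (simp add: doubleton_eq_iff)
  obtain as x y bs where xs: "xs = as @ x # y # bs" and xy: "xs ! i = x" "xs ! Suc i = y"
    using i(1) by (rule split_at_nth)
  have "rev xs = rev bs @ y # x # rev as" by (simp add: xs)
  then have "xs = as @ u # w # bs \<or> rev xs = rev bs @ u # w # rev as"
    using ends xy xs by metis
  moreover have "path_in (co ?F') X (rev xs) \<longleftrightarrow> path_in (co ?F') X xs"
    by (rule path_in_rev) (rule co'sym)
  then have "path_in (co ?F') X (rev xs)" "set (rev xs) = X"
    using path by simp_all
  ultimately obtain as bs zs where zs: "zs = as @ u # w # bs" and
    pzs: "path_in (co ?F') X zs" "set zs = X"
    using path by blast
  have dist: "distinct zs" and szs: "successively (co ?F') zs" using pzs by (auto simp: path_in_def)
  have left: "successively (co F) (as @ [u])"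
  proof -
    have "successively (co ?F') (as @ [u])"
      using szs by (auto simp: zs successively_append_iff successively_Cons)
    moreover have "w \<notin> set (as @ [u])" using dist by (auto simp: zs)
    ultimately show ?thesis by (elim successively_mono) (auto simp: co_def doubleton_eq_iff)
  qed
  have right: "successively (co F) (w # bs)"
  proof -
    have "successively (co ?F') (w # bs)"
      using szs by (auto simp: zs successively_append_iff successively_Cons)
    moreover have "u \<notin> set (w # bs)" using dist by (auto simp: zs)
    ultimately show ?thesis by (elim successively_mono) (auto simp: co_def doubleton_eq_iff)
  qed
  define l where "l = length zs"
  define k where "k = length as"
  have l: "l = card X" using dist pzs(2) by (simp add: l_def distinct_card[symmetric])
  have kl: "Suc k < l" and zk: "zs ! k = u" "zs ! Suc k = w"
    by (auto simp: k_def l_def zs nth_append)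
  define I where "I = {i. i < l \<and> zs ! i \<in> {y. co F u y}}"
  define J where "J = {i. i < l \<and> zs ! i \<in> {y. co F w y}}"
  have nbrs: "card {y \<in> X. co F v y} + card {y \<in> X. F v y} + 1 = l" if "v \<in> X" for v
  proof -
    have "X = insert v ({y \<in> X. co F v y} \<union> {y \<in> X. F v y})" using that by (auto simp: co_def)
    then have "card X = Suc (card ({y \<in> X. co F v y} \<union> {y \<in> X. F v y}))"
      using fin irr by (subst card_insert_disjoint[symmetric]) (auto simp: co_def)
    also have "card ({y \<in> X. co F v y} \<union> {y \<in> X. F v y}) = card {y \<in> X. co F v y} + card {y \<in> X. F v y}"
      using fin by (intro card_Un_disjoint) (auto simp: co_def)
    finally show ?thesis using l by simp
  qed
  have cardI: "card I = card {y \<in> X. co F u y}" and cardJ: "card J = card {y \<in> X. co F w y}"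
    using card_nth_Collect[OF dist, of "{y. co F u y}"] card_nth_Collect[OF dist, of "{y. co F w y}"] pzs(2)
    by (simp_all add: I_def J_def l_def Int_def)
  have uX: "u \<in> X" "w \<in> X" using FX uw by auto
  have last_I: "i \<noteq> l - 1" if "i \<in> I" for i
  proof
    assume "i = l - 1"
    then have "co F u (last zs)" using that by (simp add: I_def l_def zs last_conv_nth)
    moreover have "hd (rev (w # bs)) = last zs" by (simp only: hd_rev) (simp add: zs)
    ultimately have "successively (co F) ((as @ [u]) @ rev (w # bs))"
      by (intro successively_appendI[OF left rev_succ[OF right], of u "last zs"]) auto
    then show False by (rule not_path) (use dist pzs(2) in \<open>auto simp: zs\<close>)
  qed
  have pos_J: "i \<noteq> 0" if "i \<in> J" for i
  proof
    assume "i = 0"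
    then have "co F w (hd zs)" using that by (simp add: J_def zs hd_conv_nth)
    moreover have "last (rev (as @ [u])) = hd zs" by (cases as) (auto simp: zs)
    ultimately have "successively (co F) (rev (as @ [u]) @ w # bs)"
      using cosym by (intro successively_appendI[OF rev_succ[OF left] right, of "hd zs" w]) auto
    then show False by (rule not_path) (use dist pzs(2) in \<open>auto simp: zs\<close>)
  qed
  have disj: "Suc i \<notin> J" if "i \<in> I" for i
  proof
    assume J: "Suc i \<in> J"
    then have il: "Suc i < l" by (simp add: J_def)
    have co: "co F u (zs ! i)" "co F w (zs ! Suc i)" using that J by (auto simp: I_def J_def)
    have ik: "i \<noteq> k" using zk co(1) by (auto simp: co_def)
    show False
    proof (cases "i < k")
      case True
      then have "Suc i < length (as @ [u])" by (simp add: k_def)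
      then obtain ps a b qs where ab: "as @ [u] = ps @ a # b # qs"
        "(as @ [u]) ! i = a" "(as @ [u]) ! Suc i = b" by (rule split_at_nth)
      have zs': "zs = (as @ [u]) @ w # bs" by (simp add: zs)
      then have "zs ! i = (as @ [u]) ! i" "zs ! Suc i = (as @ [u]) ! Suc i"
        using True by (auto simp: nth_append k_def)
      then have c: "co F u a" "co F w b" using co ab by auto
      have "last (b # qs) = u" using arg_cong[OF ab(1), of last] by simp
      then have "hd (rev (b # qs) @ (w # bs)) = u" by (metis append_is_Nil_conv hd_append hd_rev list.discI rev_is_Nil_conv)
      moreover have ps: "successively (co F) (ps @ [a])" and qs: "successively (co F) (b # qs)"
        using left unfolding ab(1) by (auto simp: successively_append_iff successively_Cons)
      \<comment> \<open>The new path runs up to \<open>a\<close>, jumps to \<open>u\<close>, goes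
        back to \<open>b\<close> and jumps to \<open>w\<close>.\<close>
      have "successively (co F) (rev (b # qs) @ (w # bs))"
        using cosym[OF c(2)] by (intro successively_appendI[OF rev_succ[OF qs] right, of b w]) auto
      ultimately have "successively (co F) ((ps @ [a]) @ rev (b # qs) @ (w # bs))"
        using cosym[OF c(1)] by (intro successively_appendI[OF ps, of _ a u]) auto
      moreover have "set ((ps @ [a]) @ rev (b # qs) @ (w # bs)) = set zs"
        unfolding zs' ab(1) by auto
      moreover have "distinct ((ps @ [a]) @ rev (b # qs) @ (w # bs))"
        using dist unfolding zs' ab(1) by auto
      ultimately show False using not_path pzs(2) by metis
    next
      case False
      then obtain j where j: "i = Suc k + j" using ik by (metis Suc_leI add.commute le_iff_add nat_neq_iff)
      then have "Suc j < length (w # bs)" using il by (simp add: l_def zs k_def)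
      then obtain ps a b qs where ab: "w # bs = ps @ a # b # qs"
        "(w # bs) ! j = a" "(w # bs) ! Suc j = b" by (rule split_at_nth)
      have zs': "zs = (as @ [u]) @ (w # bs)" by (simp add: zs)
      have "zs ! i = (w # bs) ! j" "zs ! Suc i = (w # bs) ! Suc j"
        unfolding zs' j by (auto simp: nth_append k_def)
      then have c: "co F u a" "co F w b" using co ab by auto
      have "hd (ps @ [a]) = w" using arg_cong[OF ab(1), of hd] by (cases ps) auto
      then have "last (rev (ps @ [a])) = w" by (metis last_rev)
      moreover have ps: "successively (co F) (ps @ [a])" and qs: "successively (co F) (b # qs)"
        using right unfolding ab(1) by (auto simp: successively_append_iff successively_Cons)
      ultimately have "successively (co F) (rev (ps @ [a]) @ (b # qs))"
        using c(2) by (intro successively_appendI[OF rev_succ[OF ps] qs, of w b]) auto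
      \<comment> \<open>The new path jumps from \<open>u\<close> to \<open>a\<close>, goes back to
        \<open>w\<close> and jumps to \<open>b\<close>.\<close>
      then have "successively (co F) ((as @ [u]) @ rev (ps @ [a]) @ (b # qs))"
        using c(1) by (intro successively_appendI[OF left, of _ u a]) auto
      moreover have "set ((as @ [u]) @ rev (ps @ [a]) @ (b # qs)) = set zs"
        unfolding zs' ab(1) by auto
      moreover have "distinct ((as @ [u]) @ rev (ps @ [a]) @ (b # qs))"
        using dist unfolding zs' ab(1) by auto
      ultimately show False using not_path pzs(2) by metis
    qed
  qed
  \<comment> \<open>The position \<open>Suc k\<close> of \<open>w\<close> is lost as well: no vertex
    is adjacent to itself, so it is neither in \<open>J\<close> nor a shift of an element of
    \<open>I\<close>.\<close>
  have "card I + card J + card {Suc k} \<le> l - 1"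
  proof (rule card_shifted_disjoint)
    show "Suc ` I \<inter> J = {}" using disj by auto
    have "k \<notin> I" by (simp add: I_def zk co_def)
    moreover have "Suc i < l" if "i \<in> I" for i using last_I[OF that] that by (auto simp: I_def)
    ultimately show "Suc ` I \<subseteq> {1..<l} - {Suc k}" by auto
    have "Suc k \<notin> J" by (simp add: J_def zk co_def)
    then show "J \<subseteq> {1..<l} - {Suc k}" using pos_J by (force simp: J_def)
    show "{Suc k} \<subseteq> {1..<l}" using kl by simp
  qed
  then show ?thesis using cardI cardJ nbrs[OF uX(1)] nbrs[OF uX(2)] l kl by simp
qed

text \<open>
  If the complement of \<open>E\<close> has no Hamiltonian path, remove edges from \<open>E\<close> as long as this remains true.
  As in Ore's theorem, any remaining edge then has degree sum at least \<open>|X|\<close>. So some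
  remaining degree is at least \<open>n\<close> and all the non-zero ones exceed \<open>c\<close>, which yields
  a path on \<open>n\<close> vertices.
\<close>

lemma co_spanning_path:
  fixes E :: "'a \<Rightarrow> 'a \<Rightarrow> bool"
  assumes fin: "finite X" and sym: "\<And>x y. E x y \<Longrightarrow> E y x" and irr: "\<And>x. \<not> E x x"
    and no: "\<not> (\<exists>xs. path_in E X xs \<and> length xs = n)"
    and large: "2 * n \<le> card X"
    and deg: "\<And>x. x \<in> X \<Longrightarrow> c \<le> card {y \<in> X. co E x y}" and c: "n \<le> 2 * c + 3"
  shows "\<exists>xs. path_in (co E) X xs \<and> set xs = X"
proof (rule ccontr)
  assume nos: "\<not> ?thesis"
  define rel :: "('a \<times> 'a) set \<Rightarrow> 'a \<Rightarrow> 'a \<Rightarrow> bool" where "rel D x y \<longleftrightarrow> (x, y) \<in> D" for D x y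
  define D0 where "D0 = {(x, y). x \<in> X \<and> y \<in> X \<and> E x y}"
  define P where "P D \<longleftrightarrow> D \<subseteq> D0 \<and> sym D \<and> \<not> (\<exists>xs. path_in (co (rel D)) X xs \<and> set xs = X)" for D
  have finD0: "finite D0"
    by (rule finite_subset[of _ "X \<times> X"]) (use fin in \<open>auto simp: D0_def\<close>)
  have "P D0"
  proof -
    have "path_in (co E) X xs" if "path_in (co (rel D0)) X xs" for xs
      using that by (auto simp: path_in_def co_def rel_def D0_def elim!: successively_mono)
    then show ?thesis using nos sym by (auto simp: P_def D0_def sym_def)
  qed
  then obtain D where PD: "P D" and min: "\<And>D'. P D' \<Longrightarrow> card D \<le> card D'"
    using ex_has_least_nat[of P D0 card] by blast
  define F where "F = rel D"
  have Fsym: "\<And>x y. F x y \<Longrightarrow> F y x" using PD by (auto simp: P_def F_def rel_def sym_def)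
  have FE: "\<And>x y. F x y \<Longrightarrow> x \<in> X \<and> y \<in> X \<and> E x y"
    using PD by (auto simp: P_def F_def rel_def D0_def)
  have Firr: "\<And>x. \<not> F x x" using FE irr by blast
  have noF: "\<not> (\<exists>xs. path_in (co F) X xs \<and> set xs = X)" using PD by (simp add: P_def F_def)
  define d where "d v = card {y \<in> X. F v y}" for v
  have ore: "card X \<le> d u + d w" if "F u w" for u w
  proof -
    define D' where "D' = D - {(u, w), (w, u)}"
    have "card D' < card D"
    proof (rule psubset_card_mono)
      show "finite D" using PD finD0 finite_subset by (auto simp: P_def)
      show "D' \<subset> D" using that by (auto simp: D'_def F_def rel_def)
    qed
    then have "\<not> P D'" using min by fastforce
    moreover have "D' \<subseteq> D0" "sym D'" using PD by (auto simp: P_def D'_def sym_def)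
    ultimately obtain xs where xs: "path_in (co (rel D')) X xs" "set xs = X"
      by (auto simp: P_def)
    have "rel D' = (\<lambda>x y. F x y \<and> {x, y} \<noteq> {u, w})"
      by (auto simp: fun_eq_iff rel_def D'_def F_def doubleton_eq_iff)
    then show ?thesis
      unfolding d_def using spanning_path_co_remove_edge[of X F u w xs] fin Fsym Firr FE noF xs that
      by metis
  qed
  have "D \<noteq> {}"
  proof
    assume "D = {}"
    obtain xs where "distinct xs" "set xs = X" using finite_distinct_list[OF fin] by blast
    then have "path_in (co F) X xs"
      by (auto simp: path_in_def co_def F_def rel_def \<open>D = {}\<close> successively_conv_nth nth_eq_iff_index_eq)
    then show False using noF \<open>set xs = X\<close> by blast
  qed
  then obtain u0 w0 where "F u0 w0" by (auto simp: F_def rel_def)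
  then have "\<exists>u w. F u w \<and> d w \<le> d u" using Fsym by (meson linear)
  then obtain u w where u: "F u w" "d w \<le> d u" by blast
  have du: "n \<le> d u" using ore[OF u(1)] u(2) large by simp
  define V where "V = {x. \<exists>y. F x y}"
  have VX: "V \<subseteq> X" using FE by (auto simp: V_def)
  \<comment> \<open>A neighbour \<open>b\<close> of \<open>a\<close> has at least \<open>c\<close>
    non-neighbours in \<open>X\<close>, so its degree is at most |X| - 1 - c, and the degree sum
    leaves at least \<open>c + 1\<close> for \<open>a\<close>.\<close>
  have dV: "c + 1 \<le> d a" if "a \<in> V" for a
  proof -
    obtain b where b: "F a b" using \<open>a \<in> V\<close> by (auto simp: V_def)
    then have bX: "b \<in> X" using FE by blast
    have "card ({y \<in> X. F b y} \<union> {y \<in> X. co E b y}) \<le> card (X - {b})"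
      using fin Firr by (intro card_mono) (auto simp: co_def)
    moreover have "card ({y \<in> X. F b y} \<union> {y \<in> X. co E b y}) = d b + card {y \<in> X. co E b y}"
      unfolding d_def using fin FE by (intro card_Un_disjoint) (auto simp: co_def)
    ultimately have "d b + c \<le> card X - 1" using deg[OF bX] bX by (simp add: card_Diff_singleton)
    moreover have "0 < card X" using bX fin by (auto simp: card_gt_0_iff)
    ultimately show ?thesis using ore[OF b] by linarith
  qed
  \<comment> \<open>With \<open>B = {u}\<close> and at least \<open>c\<close> neighbours besides
    \<open>u\<close>, rotations give 2(c + 1) + 1 >= n vertices; as \<open>u\<close> has degree at
    least \<open>n\<close>, it has a neighbour off every shorter path.\<close>
  have "\<exists>xs. path_in F V xs \<and> length xs = n"
  proof (rule long_path_through[of V F "{u}" c n "[u]"])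
    show "finite V" using VX fin finite_subset by blast
    show "{u} \<subseteq> V" "path_in F V [u]" using u by (auto simp: V_def path_in_def)
    show "F x y \<Longrightarrow> F y x" for x y by (rule Fsym)
    show "\<not> F x x" for x by (rule Firr)
    show "\<not> F x y" if "x \<in> {u}" "y \<in> {u}" for x y using that Firr by simp
    show "n \<le> 2 * (c + card {u}) + 1" using c by simp
    show "{u} \<subseteq> set [u]" "[u] \<noteq> []" by auto
  next
    fix v assume v: "v \<in> V - {u}"
    have "{y \<in> X. F v y} \<subseteq> insert u {w \<in> V - {u}. F v w}"
      using Fsym by (auto simp: V_def)
    then have "d v \<le> card (insert u {w \<in> V - {u}. F v w})"
      unfolding d_def using finite_subset[OF VX fin] by (intro card_mono) auto
    also have "\<dots> \<le> Suc (card {w \<in> V - {u}. F v w})" by (simp add: card_insert_le_m1)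
    finally show "c \<le> card {w \<in> V - {u}. F v w}" using dV[of v] v by simp
  next
    fix v xs assume v: "v \<in> {u}" and xs: "path_in F V xs" "length xs < n"
    have "card (set xs) < d u" using xs du by (simp add: path_in_def distinct_card)
    then have "\<not> {y \<in> X. F u y} \<subseteq> set xs" unfolding d_def by (meson List.finite_set card_mono not_le)
    then show "\<exists>w \<in> V - set xs. F v w" using v Fsym by (auto simp: V_def)
  qed simp
  then obtain xs where "path_in F V xs" "length xs = n" by blast
  then have "path_in E X xs" using path_in_mono[of F V xs E X] FE VX by blast
  then show False using no \<open>length xs = n\<close> by blast
qed

section \<open>Graphs without a path on a given number of vertices\<close>

lemma rtranclp_leaves_set:
  assumes "E\<^sup>*\<^sup>* x y" "x \<in> S" "y \<notin> S"
  shows "\<exists>a b. E\<^sup>*\<^sup>* x a \<and> a \<in> S \<and> b \<notin> S \<and> E a b"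
  using assms
proof (induction rule: rtranclp_induct)
  case (step y z)
  then show ?case by (cases "y \<in> S") auto
qed simp

section \<open>Components and non-neighbours\<close>

definition comp_of :: "('a \<Rightarrow> 'a \<Rightarrow> bool) \<Rightarrow> 'a \<Rightarrow> 'a set" where
  "comp_of E x = {y. E\<^sup>*\<^sup>* x y}"

lemma comp_of_refl: "x \<in> comp_of E x"
  by (simp add: comp_of_def)

lemma comp_of_eq:
  assumes sym: "\<And>x y. E x y \<Longrightarrow> E y x" and "y \<in> comp_of E x"
  shows "comp_of E y = comp_of E x"
proof -
  have "symp E" using sym by (simp add: symp_def)
  then have "symp E\<^sup>*\<^sup>*" by (rule symp_rtranclp)
  then have "E\<^sup>*\<^sup>* y x" using assms(2) by (simp add: comp_of_def symp_def)
  then show ?thesis using assms(2) by (auto simp: comp_of_def)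
qed

lemma comp_of_nbrs: "insert x {y. E x y} \<subseteq> comp_of E x"
  by (auto simp: comp_of_def)

locale finite_path_free =
  fixes E :: "'a \<Rightarrow> 'a \<Rightarrow> bool" and V :: "'a set" and n :: nat
  assumes fin: "finite V" and sym: "\<And>x y. E x y \<Longrightarrow> E y x" and irr: "\<And>x. \<not> E x x"
    and EV: "\<And>x y. E x y \<Longrightarrow> x \<in> V \<and> y \<in> V"
    and n2: "2 \<le> n" and path_free: "\<not> (\<exists>xs. path_in E V xs \<and> length xs = n)"
begin

lemma finite_nbrs: "finite {y. E x y}"
  by (rule finite_subset[OF _ fin]) (use EV in auto)

lemma comp_of_subset: "x \<in> V \<Longrightarrow> comp_of E x \<subseteq> V"
proof
  fix y assume "x \<in> V" "y \<in> comp_of E x"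
  then have "E\<^sup>*\<^sup>* x y" by (simp add: comp_of_def)
  then show "y \<in> V" using \<open>x \<in> V\<close> by (induction rule: rtranclp_induct) (use EV in auto)
qed

lemma card_nbrs_co: "x \<in> V \<Longrightarrow> card {y. E x y} + card {y \<in> V. co E x y} + 1 = card V"
proof -
  assume x: "x \<in> V"
  have "V = insert x ({y. E x y} \<union> {y \<in> V. co E x y})" using x EV by (auto simp: co_def)
  then have "card V = Suc (card ({y. E x y} \<union> {y \<in> V. co E x y}))"
    using fin irr finite_nbrs by (subst card_insert_disjoint[symmetric]) (auto simp: co_def)
  also have "card ({y. E x y} \<union> {y \<in> V. co E x y}) = card {y. E x y} + card {y \<in> V. co E x y}"
    using fin finite_nbrs by (intro card_Un_disjoint) (auto simp: co_def)
  finally show ?thesis by simp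
qed

text \<open>In a component with at least \<open>n\<close> vertices, connectivity gives every shorter
  path an edge leaving it. Rotations with \<open>B = {}\<close> and minimum degree
  \<open>n div 2\<close> would then produce a path on 2(n div 2) + 1 >= n vertices.\<close>

lemma card_comp_of_less:
  assumes deg: "\<And>v. v \<in> V \<Longrightarrow> n div 2 \<le> card {w. E v w}" and x: "x \<in> V"
  shows "card (comp_of E x) < n"
proof (rule ccontr)
  assume large: "\<not> card (comp_of E x) < n"
  let ?C = "comp_of E x"
  have finC: "finite ?C" using comp_of_subset[OF x] fin finite_subset by blast
  have "\<exists>xs. path_in E ?C xs \<and> length xs = n"
  proof (rule long_path_through[of ?C E "{}" "n div 2" n "[x]"])
    show "finite ?C" by (rule finC)
    show "path_in E ?C [x]" by (simp add: path_in_def comp_of_refl)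
    show "n \<le> 2 * (n div 2 + card {}) + 1" by simp
  next
    fix v assume v: "v \<in> ?C - {}"
    have "{w \<in> ?C - {}. E v w} = {w. E v w}" using v by (auto simp: comp_of_def)
    then show "n div 2 \<le> card {w \<in> ?C - {}. E v w}" using deg v comp_of_subset[OF x] by auto
  next
    fix xs assume xs: "path_in E ?C xs" "xs \<noteq> []" "length xs < n"
    then have "card (set xs) < card ?C" using large by (simp add: path_in_def distinct_card)
    then have "\<not> ?C \<subseteq> set xs" by (meson List.finite_set card_mono not_le)
    then obtain y where y: "y \<in> ?C" "y \<notin> set xs" by blast
    have "hd xs \<in> ?C" using xs by (auto simp: path_in_def)
    then have eq: "comp_of E (hd xs) = ?C" using comp_of_eq[of E "hd xs" x] sym by blast
    then have "E\<^sup>*\<^sup>* (hd xs) y" using y by (auto simp: comp_of_def)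
    from rtranclp_leaves_set[OF this, of "set xs"] xs y obtain a b where
      ab: "E\<^sup>*\<^sup>* (hd xs) a" "a \<in> set xs" "b \<notin> set xs" "E a b" by auto
    then have "b \<in> comp_of E (hd xs)" by (auto simp: comp_of_def)
    then show "\<exists>a \<in> set xs. \<exists>w \<in> ?C - set xs. E a w" using ab eq by blast
  qed (use sym irr in auto)
  then show False using path_free path_in_mono[of E ?C _ E V] comp_of_subset[OF x] by blast
qed

lemma no_path_in_subset: "X \<subseteq> V \<Longrightarrow> \<not> (\<exists>xs. path_in E X xs \<and> length xs = n)"
  using path_free path_in_mono[of E X _ E V] by blast

text \<open>Components have at most \<open>n - 1\<close> vertices, so there are more than
  \<open>b\<close> of them. If every vertex had fewer than \<open>m\<close> non-neighbours, each
  component would have at least |V| - m + 1 vertices, and \<open>b + 1\<close> components would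
  contradict the second inequality in \<open>b\<close>.\<close>

lemma exists_low_degree:
  fixes b m :: nat
  assumes deg: "\<And>v. v \<in> V \<Longrightarrow> n div 2 \<le> card {w. E v w}"
    and b: "(n - 1) * b < card V" "(b + 1) * (m - 1) < b * card V" and m: "1 \<le> m"
  shows "\<exists>v \<in> V. m \<le> card {y \<in> V. co E v y}"
proof (rule ccontr)
  assume "\<not> ?thesis"
  then have few: "card {y \<in> V. co E v y} < m" if "v \<in> V" for v using that by force
  define P where "P = comp_of E ` V"
  have finP: "finite P" using fin by (simp add: P_def)
  have PV: "\<Union>P = V" using comp_of_subset comp_of_refl by (force simp: P_def)
  have "pairwise disjnt P"
  proof (rule pairwiseI)
    fix A B assume "A \<in> P" "B \<in> P" "A \<noteq> B"
    then show "disjnt A B"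
      using comp_of_eq[of E] sym by (auto simp: P_def disjnt_def) metis+
  qed
  then have cardV: "card V = sum card P"
    using card_Union_disjoint[of P] PV fin by (metis Union_upper finite_subset)
  have up: "card A \<le> n - 1" if "A \<in> P" for A
    using card_comp_of_less[OF deg] that by (fastforce simp: P_def)
  have lo: "card V - m + 1 \<le> card A" if A: "A \<in> P" for A
  proof -
    obtain v where v: "v \<in> V" "A = comp_of E v" using A by (auto simp: P_def)
    have finA: "finite A" using PV A fin by (metis Union_upper finite_subset)
    have "card (insert v {y. E v y}) \<le> card A"
      using comp_of_nbrs[of v E] v finA by (metis card_mono)
    moreover have "card (insert v {y. E v y}) = Suc (card {y. E v y})"
      using irr finite_nbrs by simp
    ultimately show ?thesis using card_nbrs_co[OF v(1)] few[OF v(1)] by linarith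
  qed
  have "card V \<le> card P * (n - 1)" using sum_bounded_above[of P card "n - 1"] up cardV by simp
  then have "b < card P"
    using b(1) by (metis le_less_trans leI mult.commute mult_le_mono2 not_le)
  then have "(b + 1) * (card V - m + 1) \<le> card P * (card V - m + 1)" by (intro mult_right_mono) auto
  also have "\<dots> \<le> card V" using sum_bounded_below[of P "card V - m + 1" card] lo cardV by simp
  finally have le: "(b + 1) * (card V - m + 1) \<le> card V" .
  \<comment> \<open>This makes the truncated subtraction in \<open>card V - m + 1\<close>
    exact.\<close>
  have "m \<le> card V"
  proof (rule ccontr)
    assume "\<not> m \<le> card V"
    then have "card V \<le> m - 1" by simp
    then have "b * card V \<le> (b + 1) * (m - 1)" by (intro mult_mono) auto
    then show False using b(2) by simp
  qed
  then obtain s where s: "card V = m + s" using le_Suc_ex by blast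
  obtain m' where m': "m = Suc m'" using m by (cases m) auto
  show False using le b(2) unfolding s m' by (simp add: algebra_simps)
qed

text \<open>The number \<open>b\<close> will be \<open>t_beta n m\<close>; its two inequalities
  enter when \<open>B\<close> is empty and components are counted.\<close>

lemma join_path_large:
  fixes b m :: nat
  assumes m: "2 * n \<le> m" and large: "m + n div 2 \<le> card V"
    and b: "(n - 1) * b < card V" "(b + 1) * (m - 1) < b * card V"
  shows "\<exists>v \<in> V. \<exists>xs. path_in (co E) V xs \<and> length xs = m \<and> (\<forall>x \<in> set xs. co E v x)"
proof -
  define k where "k = n div 2"
  have k: "1 \<le> k" "2 * k \<le> n" "n \<le> 2 * k + 1" using n2 by (auto simp: k_def)
  \<comment> \<open>It suffices to find at least \<open>m\<close> non-neighbours of \<open>v\<close>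
    with complement degrees of about n/2 among themselves: the spanning path is cut to
    \<open>m\<close> vertices.\<close>
  have from_set: ?thesis
    if "v \<in> V" "X \<subseteq> {y \<in> V. co E v y}" "m \<le> card X"
      and X: "\<And>x. x \<in> X \<Longrightarrow> c \<le> card {y \<in> X. co E x y}" "n \<le> 2 * c + 3" for v X c
  proof -
    have XV: "X \<subseteq> V" using that(2) by blast
    then have finX: "finite X" using fin by (rule finite_subset)
    have "\<exists>xs. path_in (co E) X xs \<and> set xs = X"
      by (rule co_spanning_path[OF finX sym irr no_path_in_subset[OF XV] _ X]) (use m that(3) in auto)
    then obtain xs where xs: "path_in (co E) X xs" "set xs = X" by blast
    then have "m \<le> length xs" using that(3) by (simp add: path_in_def distinct_card[symmetric])
    moreover have "path_in (co E) V (take m xs)"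
      using path_in_take[OF xs(1)] path_in_mono[of "co E" X _ "co E" V] XV by blast
    moreover have "\<forall>x \<in> set (take m xs). co E v x"
      using xs(2) that(2) set_take_subset[of m xs] by blast
    ultimately show ?thesis using that(1) by (intro bexI[of _ v] exI[of _ "take m xs"]) auto
  qed
  define B where "B = {u \<in> V. card {y \<in> V. co E u y} < n}"
  have BV: "B \<subseteq> V" and finB: "finite B" using fin by (auto simp: B_def)
  show ?thesis
  proof (cases "\<exists>v \<in> V - B. card ({w. E v w} \<union> B) < k")
    case True
    then obtain v where v: "v \<in> V" "v \<notin> B" and small: "card ({w. E v w} \<union> B) < k" by blast
    define W where "W = insert v ({w. E v w} \<union> B)"
    have finW: "finite W" using finB finite_nbrs by (simp add: W_def)
    have cardW: "card W \<le> k" using small by (simp add: W_def card_insert_le_m1)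
    \<comment> \<open>Vertices outside \<open>B\<close> have at least \<open>n\<close>
      non-neighbours, and at most \<open>k\<close> of these are deleted with
      \<open>W\<close>.\<close>
    show ?thesis
    proof (rule from_set[of v "V - W" "n - k"])
      show "v \<in> V" by (rule v)
      show "V - W \<subseteq> {y \<in> V. co E v y}" by (auto simp: W_def co_def)
      show "m \<le> card (V - W)"
        using diff_card_le_card_Diff[OF finW, of V] cardW large by (simp add: k_def)
    next
      fix x assume x: "x \<in> V - W"
      then have "n \<le> card {y \<in> V. co E x y}" by (auto simp: W_def B_def)
      moreover have "card {y \<in> V. co E x y} - card W \<le> card ({y \<in> V. co E x y} - W)"
        by (rule diff_card_le_card_Diff[OF finW])
      moreover have "{y \<in> V. co E x y} - W = {y \<in> V - W. co E x y}" by auto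
      ultimately show "n - k \<le> card {y \<in> V - W. co E x y}" using cardW by simp
    next
      show "n \<le> 2 * (n - k) + 3" using k by simp
    qed
  next
    case False
    then have deg: "k \<le> card ({w. E v w} \<union> B)" if "v \<in> V - B" for v using that by (meson not_le)
    have "B = {}"
    proof (rule ccontr)
      assume "B \<noteq> {}"
      \<comment> \<open>The cap \<open>k\<close> keeps the path through \<open>A\<close> short. If
        it is attained, the degree \<open>k - card A\<close> demanded below is 0; otherwise
        \<open>A\<close> is all of \<open>B\<close>, and the bound on |N(v) \<union> B| supplies
        that degree.\<close>
      have "\<exists>A \<subseteq> B. A \<noteq> {} \<and> card A \<le> k \<and> (card A < k \<longrightarrow> A = B)"
      proof (cases "card B \<le> k")
        case True
        then show ?thesis using \<open>B \<noteq> {}\<close> by blast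
      next
        case False
        then obtain A where "A \<subseteq> B" "card A = k" by (meson nat_le_linear obtain_subset_with_card_n)
        then show ?thesis using k by (intro exI[of _ A]) auto
      qed
      then obtain A where A: "A \<subseteq> B" "A \<noteq> {}" "card A \<le> k" "card A < k \<longrightarrow> A = B" by blast
      have finA: "finite A" and AV: "A \<subseteq> V" using A(1) finB BV finite_subset by auto
      define F where "F x y \<longleftrightarrow> E x y \<and> \<not> (x \<in> A \<and> y \<in> A)" for x y
      have Fsym: "\<And>x y. F x y \<Longrightarrow> F y x" using sym by (auto simp: F_def)
      have FA: "\<And>x y. x \<in> A \<Longrightarrow> y \<in> A \<Longrightarrow> \<not> F x y" by (auto simp: F_def)
      have cardVA: "card (V - A) + card A = card V"
        using fin AV finA by (simp add: card_Diff_subset card_mono)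
      have VA: "2 * n \<le> card (V - A)" using cardVA A(3) large m by (simp add: k_def)
      define D where "D u = {w. F u w}" for u
      have DV: "D u \<subseteq> V - A" if "u \<in> A" for u using that EV by (auto simp: D_def F_def)
      have finD: "finite (D u)" for u
        by (rule finite_subset[OF _ fin]) (use EV in \<open>auto simp: D_def F_def\<close>)
      have cardD: "card (V - A) + 1 \<le> card (D u) + n" if u: "u \<in> A" for u
      proof -
        have "V - A \<subseteq> D u \<union> {y \<in> V. co E u y}" using u by (auto simp: D_def F_def co_def)
        then have "card (V - A) \<le> card (D u \<union> {y \<in> V. co E u y})"
          using fin finD by (intro card_mono) auto
        also have "\<dots> \<le> card (D u) + card {y \<in> V. co E u y}" by (rule card_Un_le)
        finally show ?thesis using u A(1) by (auto simp: B_def)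
      qed
      have "\<exists>xs. path_in F V xs \<and> A \<subseteq> set xs \<and> length xs + 1 = 2 * card A \<and> hd xs \<in> A \<and> last xs \<in> A"
      proof (rule alternating_path_through[OF finA A(2) AV Fsym FA])
        fix xs u
        assume xs: "path_in F V xs" "2 * card (set xs \<inter> A) = length xs + 1"
          and hd: "hd xs \<in> set xs \<inter> A" and last: "last xs \<in> set xs \<inter> A" and u: "u \<in> A - set xs"
        define Z where "Z = V - A - set xs"
        have finZ: "finite Z" using fin by (simp add: Z_def)
        have xsV: "set xs \<subseteq> V" using xs by (simp add: path_in_def)
        have "card (insert u (set xs \<inter> A)) \<le> card A" using u finA by (intro card_mono) auto
        then have j: "card (set xs \<inter> A) < card A" using u by simp
        have "card (set xs) = card (set xs \<inter> A) + card (set xs - A)"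
          by (metis List.finite_set card_Diff_subset_Int card_Int_Diff finite_Int)
        then have y: "card (set xs - A) + 2 \<le> card A"
          using xs j by (simp add: path_in_def distinct_card)
        have cardZ: "card Z + card (set xs - A) = card (V - A)"
        proof -
          have "card (Z \<union> (set xs - A)) = card Z + card (set xs - A)"
            using finZ by (intro card_Un_disjoint) (auto simp: Z_def)
          moreover have "Z \<union> (set xs - A) = V - A" using xsV by (auto simp: Z_def)
          ultimately show ?thesis by simp
        qed
        have DZ: "D v \<inter> Z = D v - set xs" if "v \<in> A" for v using DV[OF that] by (auto simp: Z_def)
        have cardDZ: "card (D v) \<le> card (D v \<inter> Z) + card (set xs - A)" if v: "v \<in> A" for v
        proof -
          have "D v \<subseteq> (D v \<inter> Z) \<union> (set xs - A)" using DV[OF v] by (auto simp: Z_def)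
          then have "card (D v) \<le> card ((D v \<inter> Z) \<union> (set xs - A))"
            using finZ by (intro card_mono) auto
          also have "\<dots> \<le> card (D v \<inter> Z) + card (set xs - A)" by (rule card_Un_le)
          finally show ?thesis .
        qed
        \<comment> \<open>Suppose no \<open>w\<close> works. If \<open>u\<close> has a neighbour on
          the path, the neighbourhoods of \<open>u\<close>, \<open>hd xs\<close> and
          \<open>last xs\<close> in \<open>Z\<close> are pairwise disjoint; otherwise all neighbours
          of \<open>u\<close> lie in \<open>Z\<close>, disjoint from those of \<open>hd xs\<close>.
          Each vertex of \<open>A\<close> misses fewer than \<open>n\<close> of the at least
          \<open>2 * n\<close> vertices of \<open>V - A\<close>, and the path takes at most
          \<open>k - 2\<close> of them, so \<open>Z\<close> is too small in both cases.\<close>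
        show "\<exists>w \<in> V - set xs. F u w \<and> F (hd xs) w \<or> F u w \<and> F (last xs) w \<or>
          F (hd xs) w \<and> F (last xs) w \<and> (\<exists>z \<in> set xs. F u z)"
        proof (rule ccontr)
          assume neg: "\<not> ?thesis"
          have d1: "D u \<inter> Z \<inter> (D (hd xs) \<inter> Z) = {}" and d2: "D u \<inter> Z \<inter> (D (last xs) \<inter> Z) = {}"
            using neg by (auto simp: D_def Z_def)
          show False
          proof (cases "\<exists>z \<in> set xs. F u z")
            case True
            then have "D (hd xs) \<inter> Z \<inter> (D (last xs) \<inter> Z) = {}"
              using neg by (auto simp: D_def Z_def)
            then have "card (D u \<inter> Z) + card (D (hd xs) \<inter> Z) + card (D (last xs) \<inter> Z) =
              card (D u \<inter> Z \<union> D (hd xs) \<inter> Z \<union> D (last xs) \<inter> Z)"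
              using d1 d2 finZ
              by (subst card_Un_disjoint, simp, simp, blast, subst card_Un_disjoint) auto
            also have "\<dots> \<le> card Z" using finZ by (intro card_mono) auto
            finally show False
              using cardDZ[of u] cardDZ[of "hd xs"] cardDZ[of "last xs"] cardD[of u] cardD[of "hd xs"]
                cardD[of "last xs"] u hd last cardZ y A(3) VA k by auto
          next
            case False
            then have "D u \<inter> Z = D u" using DZ[of u] u by (auto simp: D_def)
            then have "card (D u) + card (D (hd xs) \<inter> Z) = card (D u \<union> D (hd xs) \<inter> Z)"
              using d1 finZ finD by (subst card_Un_disjoint) auto
            also have "\<dots> \<le> card Z" using \<open>D u \<inter> Z = D u\<close> finZ by (intro card_mono) auto
            finally show False
              using cardDZ[of "hd xs"] cardD[of u] cardD[of "hd xs"] u hd cardZ VA n2 by auto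
          qed
        qed
      qed
      then obtain xs0 where xs0: "path_in F V xs0" "A \<subseteq> set xs0" by blast
      have "\<exists>xs. path_in F V xs \<and> length xs = n"
      proof (rule long_path_through[OF fin Fsym _ AV FA _ _ xs0, of "k - card A"])
        show "\<not> F x x" for x using irr by (simp add: F_def)
        show "n \<le> 2 * (k - card A + card A) + 1" using A(3) k by simp
        show "xs0 \<noteq> []" using xs0 A(2) by auto
      next
        fix v assume v: "v \<in> V - A"
        show "k - card A \<le> card {w \<in> V - A. F v w}"
        proof (cases "card A < k")
          case True
          then have AB: "A = B" using A(4) by blast
          have "k \<le> card ({w. E v w} \<union> B)" using deg v AB by blast
          also have "{w. E v w} \<union> B = {w \<in> V - A. F v w} \<union> A"
            using v EV by (auto simp: F_def AB)
          also have "card \<dots> \<le> card {w \<in> V - A. F v w} + card A" by (rule card_Un_le)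
          finally show ?thesis by simp
        qed simp
      next
        fix u xs assume u: "u \<in> A" and xs: "path_in F V xs" "length xs < n"
        have "card (set xs) < card (D u)"
          using xs cardD[OF u] VA by (simp add: path_in_def distinct_card)
        then have "\<not> D u \<subseteq> set xs" by (meson List.finite_set card_mono not_le)
        then show "\<exists>w \<in> V - set xs. F u w" using DV[OF u] by (auto simp: D_def)
      qed (use A(2) in auto)
      then show False using path_free path_in_mono[of F V _ E V] by (auto simp: F_def)
    qed
    then have deg': "n div 2 \<le> card {w. E v w}" if "v \<in> V" for v using deg[of v] that by (simp add: k_def)
    obtain v where v: "v \<in> V" "m \<le> card {y \<in> V. co E v y}"
      using exists_low_degree[OF deg' b] m n2 by auto
    \<comment> \<open>In the complement a vertex is adjacent to everything outside its component,
      and a component takes fewer than \<open>n\<close> of the at least \<open>2 * n\<close>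
      non-neighbours of \<open>v\<close>.\<close>
    show ?thesis
    proof (rule from_set[OF v(1) subset_refl v(2), of n])
      fix x assume "x \<in> {y \<in> V. co E v y}"
      then have x: "x \<in> V" by simp
      let ?X = "{y \<in> V. co E v y}"
      have "finite (comp_of E x)" using comp_of_subset[OF x] fin finite_subset by blast
      then have "card ?X - card (comp_of E x) \<le> card (?X - comp_of E x)"
        by (rule diff_card_le_card_Diff)
      also have "\<dots> \<le> card {y \<in> ?X. co E x y}"
        using fin by (intro card_mono) (auto simp: co_def comp_of_def)
      finally show "n \<le> card {y \<in> ?X. co E x y}"
        using card_comp_of_less[OF deg' x] v(2) m by simp
    qed simp
  qed
qed

lemma alternating_list:
  assumes "A \<inter> B = {}" "(l + 1) div 2 \<le> card A" "l div 2 \<le> card B"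
    "\<And>x y. x \<in> A \<Longrightarrow> y \<in> B \<Longrightarrow> R x y \<and> R y x"
  shows "\<exists>xs. path_in R (A \<union> B) xs \<and> length xs = l \<and> (xs \<noteq> [] \<longrightarrow> hd xs \<in> A)"
  using assms
proof (induction l arbitrary: A B)
  case (Suc l)
  then have "1 \<le> card A" by simp
  then obtain a where a: "a \<in> A" by (metis card.empty ex_in_conv not_one_le_zero)
  have finA: "finite A" by (rule card_ge_0_finite) (use \<open>1 \<le> card A\<close> in simp)
  have "\<exists>xs. path_in R (B \<union> (A - {a})) xs \<and> length xs = l \<and> (xs \<noteq> [] \<longrightarrow> hd xs \<in> B)"
    by (rule Suc.IH) (use Suc.prems a finA in auto)
  then obtain xs where xs: "path_in R (B \<union> (A - {a})) xs" "length xs = l" "xs \<noteq> [] \<longrightarrow> hd xs \<in> B"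
    by blast
  have "path_in R (A \<union> B) (a # xs)"
    using xs a Suc.prems(1,4) by (auto simp: path_in_def successively_Cons)
  then show ?case using xs a by (intro exI[of _ "a # xs"]) auto
qed (auto simp: path_in_def)

lemma join_path_small:
  assumes cardV: "card V = 2 * n - 1"
  shows "\<exists>v \<in> V. \<exists>xs. path_in (co E) V xs \<and> length xs = n \<and> (\<forall>x \<in> set xs. co E v x)"
proof (cases "\<exists>v \<in> V. card {w. E v w} < n div 2")
  case True
  then obtain v where v: "v \<in> V" "card {w. E v w} < n div 2" by blast
  let ?M = "{y \<in> V. co E v y}"
  \<comment> \<open>Of the 2n - 1 vertices only \<open>v\<close> and fewer than
    \<open>n div 2\<close> neighbours are lost, which is just enough for two paths with
    \<open>a = b = n\<close>.\<close>
  have cardM: "n + n div 2 \<le> card ?M + 1" using card_nbrs_co[OF v(1)] v(2) cardV n2 by linarith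
  have "(\<exists>xs. path_in E ?M xs \<and> length xs = n) \<or> (\<exists>xs. path_in (co E) ?M xs \<and> length xs = n)"
  proof (rule path_or_co_path)
    show "?M \<noteq> {}" using cardM n2 by (metis One_nat_def add.commute add_leE card.empty le_antisym not_less_eq_eq numeral_2_eq_2 plus_1_eq_Suc)
  qed (use fin sym irr n2 cardM in auto)
  then obtain xs where xs: "path_in (co E) ?M xs" "length xs = n"
    using no_path_in_subset[of ?M] by blast
  have "path_in (co E) V xs" using path_in_mono[OF xs(1), of "co E" V] by auto
  moreover have "\<forall>x \<in> set xs. co E v x" using xs by (auto simp: path_in_def)
  ultimately show ?thesis using v xs by blast
next
  case False
  then have deg: "n div 2 \<le> card {w. E v w}" if "v \<in> V" for v using that by (meson not_le)
  have small: "card (comp_of E x) \<le> n - 1" if "x \<in> V" for x using card_comp_of_less[OF deg that] by simp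
  have finC: "finite (comp_of E x)" if "x \<in> V" for x using comp_of_subset[OF that] fin finite_subset by blast
  have "V \<noteq> {}" using cardV n2 by auto
  then obtain x where x: "x \<in> V" by blast
  \<comment> \<open>Two components of at most \<open>n - 1\<close> vertices cannot cover 2n - 1, so
    \<open>x\<close>, \<open>y\<close> and \<open>v\<close> can be chosen in three different
    ones.\<close>
  have "\<not> V \<subseteq> comp_of E x"
    using card_mono[OF finC[OF x], of V] small[OF x] cardV n2 by auto
  then obtain y where y: "y \<in> V" "y \<notin> comp_of E x" by blast
  have "card (comp_of E x \<union> comp_of E y) \<le> (n - 1) + (n - 1)"
    using card_Un_le[of "comp_of E x" "comp_of E y"] small[OF x] small[OF y(1)] by linarith
  then have "\<not> V \<subseteq> comp_of E x \<union> comp_of E y"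
    using card_mono[of "comp_of E x \<union> comp_of E y" V] finC x y(1) cardV n2 by auto
  then obtain v where v: "v \<in> V" "v \<notin> comp_of E x" "v \<notin> comp_of E y" by blast
  have diff: "co E a b" if "a \<in> comp_of E p" "b \<in> comp_of E q" "q \<notin> comp_of E p" for a b p q
  proof -
    have "b \<notin> comp_of E p"
      using that comp_of_eq[of E b q] comp_of_eq[of E b p] sym comp_of_refl[of q E] by blast
    then show ?thesis
      using that(1) by (auto simp: co_def comp_of_def intro: rtranclp.rtrancl_into_rtrancl)
  qed
  have cosym: "co E a b \<Longrightarrow> co E b a" for a b using co_sym[of E] sym by blast
  have "\<exists>xs. path_in (co E) (comp_of E x \<union> comp_of E y) xs \<and> length xs = n \<and> (xs \<noteq> [] \<longrightarrow> hd xs \<in> comp_of E x)"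
  proof (rule alternating_list)
    have ge: "n div 2 + 1 \<le> card (comp_of E p)" if "p \<in> V" for p
    proof -
      have "card (insert p {q. E p q}) \<le> card (comp_of E p)"
        by (rule card_mono[OF finC[OF that] comp_of_nbrs])
      then show ?thesis using deg[OF that] irr finite_nbrs by simp
    qed
    show "(n + 1) div 2 \<le> card (comp_of E x)" using ge[OF x] by linarith
    show "n div 2 \<le> card (comp_of E y)" using ge[OF y(1)] by linarith
    show "comp_of E x \<inter> comp_of E y = {}" using diff[of _ x _ y] y(2) co_irrefl[of E] by blast
    show "co E a b \<and> co E b a" if "a \<in> comp_of E x" "b \<in> comp_of E y" for a b
      using diff[OF that y(2)] cosym by blast
  qed
  then obtain xs where xs: "path_in (co E) (comp_of E x \<union> comp_of E y) xs" "length xs = n" by blast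
  have "path_in (co E) V xs"
    using path_in_mono[OF xs(1), of "co E" V] comp_of_subset x y(1) by auto
  moreover have "\<forall>z \<in> set xs. co E v z"
  proof
    fix z assume "z \<in> set xs"
    then have "z \<in> comp_of E x \<or> z \<in> comp_of E y" using xs by (auto simp: path_in_def)
    then show "co E v z"
      using diff[of z x v v] diff[of z y v v] v comp_of_refl[of v E] cosym by blast
  qed
  ultimately show ?thesis using v(1) xs(2) by blast
qed

end

section \<open>Copies of paths and of joins\<close>

text \<open>Arcs are pairs here, so \<open>f\<close> on the vertices and \<open>map_prod f f\<close>
  on the arcs form an isomorphism onto the image, which is a subgraph.\<close>

lemma contains_copyI:
  assumes wf: "pair_wf_digraph G" "pair_wf_digraph H"
    and inj: "inj_on f (pverts H)" and verts: "f ` pverts H \<subseteq> pverts G"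
    and arcs: "\<And>u v. (u, v) \<in> parcs H \<Longrightarrow> (f u, f v) \<in> parcs G"
  shows "contains_copy G H"
proof -
  interpret H: pair_wf_digraph H by fact
  define hom where
    "hom = \<lparr>iso_verts = f, iso_arcs = map_prod f f, iso_head = snd, iso_tail = fst\<rparr>"
  have "inj_on (map_prod f f) (parcs H)"
  proof (rule inj_on_subset)
    show "inj_on (map_prod f f) (pverts H \<times> pverts H)" using inj by (rule map_prod_inj_on) (rule inj)
  qed (use H.in_arcsD1 H.in_arcsD2 in auto)
  then have hom: "H.digraph_isomorphism hom"
    using inj wf(2) by (auto simp: pre_digraph.digraph_isomorphism_def hom_def wf_digraph_wp_iff)
  have "subgraph (app_iso hom (with_proj H)) (with_proj G)"
    unfolding subgraph_def compatible_def
    using wf(1) verts arcs H.wf_digraphI_app_iso[OF hom]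
    by (auto simp: hom_def wf_digraph_wp_iff app_iso_def)
  then show ?thesis
    unfolding contains_copy_def digraph_iso_def using hom by blast
qed

lemma contains_copyD:
  assumes "contains_copy G H"
  shows "\<exists>f. inj_on f (pverts H) \<and> f ` pverts H \<subseteq> pverts G \<and>
    (\<forall>u v. (u, v) \<in> parcs H \<longrightarrow> (f u, f v) \<in> parcs G)"
proof -
  obtain hom where hom: "pre_digraph.digraph_isomorphism (with_proj H) hom"
    and sub: "subgraph (app_iso hom (with_proj H)) (with_proj G)"
    using assms by (auto simp: contains_copy_def digraph_iso_def)
  show ?thesis
  proof (intro exI conjI allI impI)
    show "inj_on (iso_verts hom) (pverts H)" "iso_verts hom ` pverts H \<subseteq> pverts G"
      using hom sub by (auto simp: pre_digraph.digraph_isomorphism_def subgraph_def)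
    fix u v assume uv: "(u, v) \<in> parcs H"
    then have "iso_arcs hom (u, v) \<in> parcs G" using sub by (auto simp: subgraph_def)
    moreover have "fst (iso_arcs hom (u, v)) = iso_verts hom u" "snd (iso_arcs hom (u, v)) = iso_verts hom v"
      using hom sub uv
      by (auto simp: pre_digraph.digraph_isomorphism_def subgraph_def compatible_def)
    ultimately show "(iso_verts hom u, iso_verts hom v) \<in> parcs G" by (metis prod.collapse)
  qed
qed

text \<open>Arcs may join neighbouring places but need not: the ordering presents the part of
  \<open>F\<close> on \<open>S\<close> as a spanning subgraph of a path, so it embeds wherever a
  path of that order does.\<close>

definition path_enumeration :: "'a pair_pre_digraph \<Rightarrow> 'a set \<Rightarrow> 'a list \<Rightarrow> bool" where
  "path_enumeration F S xs \<longleftrightarrow> distinct xs \<and> set xs = S \<and>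
    (\<forall>i < length xs. \<forall>j < length xs. (xs ! i, xs ! j) \<in> parcs F \<longrightarrow> j = Suc i \<or> i = Suc j)"

lemma path_enumeration_append:
  assumes "path_enumeration F A xs" "path_enumeration F B ys" "A \<inter> B = {}"
    and "\<And>a b. a \<in> A \<Longrightarrow> b \<in> B \<Longrightarrow> (a, b) \<notin> parcs F \<and> (b, a) \<notin> parcs F"
  shows "path_enumeration F (A \<union> B) (xs @ ys)"
proof -
  have "j = Suc i \<or> i = Suc j"
    if ij: "i < length (xs @ ys)" "j < length (xs @ ys)" "((xs @ ys) ! i, (xs @ ys) ! j) \<in> parcs F" for i j
  proof -
    have inA: "xs ! p \<in> A" if "p < length xs" for p using that assms(1) by (auto simp: path_enumeration_def)
    have inB: "ys ! p \<in> B" if "p < length ys" for p using that assms(2) by (auto simp: path_enumeration_def)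
    have "i - length xs < length ys" if "\<not> i < length xs" using that ij by simp
    moreover have "j - length xs < length ys" if "\<not> j < length xs" using that ij by simp
    ultimately have "(i < length xs) = (j < length xs)"
      using ij(3) assms(4)[OF inA inB, of i "j - length xs"] assms(4)[OF inA inB, of j "i - length xs"]
      by (auto simp: nth_append split: if_splits)
    show ?thesis
    proof (cases "i < length xs")
      case True
      then have "i < length xs" "j < length xs" "(xs ! i, xs ! j) \<in> parcs F"
        using ij(3) \<open>(i < length xs) = (j < length xs)\<close> by (auto simp: nth_append)
      then show ?thesis using assms(1) unfolding path_enumeration_def by blast
    next
      case False
      then have "i - length xs < length ys" "j - length xs < length ys"
        "(ys ! (i - length xs), ys ! (j - length xs)) \<in> parcs F"
        using ij \<open>(i < length xs) = (j < length xs)\<close> by (auto simp: nth_append)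
      then have "j - length xs = Suc (i - length xs) \<or> i - length xs = Suc (j - length xs)"
        using assms(2) unfolding path_enumeration_def by blast
      then show ?thesis using False \<open>(i < length xs) = (j < length xs)\<close> by linarith
    qed
  qed
  then show ?thesis using assms(1-3) by (auto simp: path_enumeration_def)
qed

text \<open>Each component is listed along its isomorphism with a path, and the lists are
  concatenated; arcs never join distinct components.\<close>

lemma linear_forest_enumeration:
  assumes "linear_forest F"
  shows "\<exists>xs. path_enumeration F (pverts F) xs"
proof -
  have pg: "pair_graph F" using assms by (simp add: linear_forest_def undirected_forest_def)
  interpret F: pair_graph F by (rule pg)
  have one: "\<exists>xs. path_enumeration F S xs" if S: "S \<in> F.sccs_verts" for S
  proof -
    let ?C = "with_proj F \<restriction> S"
    obtain k hom where hom: "pre_digraph.digraph_isomorphism ?C hom"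
      and eq: "with_proj (path_graph k) = app_iso hom ?C"
      using assms F.in_verts_sccsD_sccs[OF S] by (auto simp: linear_forest_def digraph_iso_def)
    let ?f = "iso_verts hom"
    have inj: "inj_on ?f S" using hom by (auto simp: pre_digraph.digraph_isomorphism_def)
    have img: "?f ` S = {..<k}"
      using arg_cong[OF eq, of verts] by (simp add: path_graph_def)
    have arcs: "?f v = Suc (?f u) \<or> ?f u = Suc (?f v)" if "(u, v) \<in> parcs F" "u \<in> S" "v \<in> S" for u v
    proof -
      have e: "(u, v) \<in> arcs ?C" using that by simp
      then have "iso_arcs hom (u, v) \<in> parcs (path_graph k)"
        using arg_cong[OF eq, of arcs] by auto
      moreover have "fst (iso_arcs hom (u, v)) = ?f u" "snd (iso_arcs hom (u, v)) = ?f v"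
        using hom e arg_cong[OF eq, of tail] arg_cong[OF eq, of head]
        by (auto simp: pre_digraph.digraph_isomorphism_def)
      ultimately show ?thesis by (cases "iso_arcs hom (u, v)") (auto simp: path_graph_def)
    qed
    define g where "g = the_inv_into S ?f"
    have g: "g i \<in> S" "?f (g i) = i" if "i < k" for i
      using that img inj f_the_inv_into_f[of ?f S i] the_inv_into_into[of ?f S i S]
      by (auto simp: g_def)
    have "path_enumeration F S (map g [0..<k])"
      unfolding path_enumeration_def
    proof (intro conjI allI impI)
      have "inj_on g {..<k}" using g by (metis inj_onI lessThan_iff)
      then show "distinct (map g [0..<k])" by (simp add: distinct_map atLeast0LessThan)
      show "set (map g [0..<k]) = S"
        using the_inv_into_onto[OF inj] img by (simp add: g_def atLeast0LessThan)
    next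
      fix i j assume "i < length (map g [0..<k])" "j < length (map g [0..<k])"
        "(map g [0..<k] ! i, map g [0..<k] ! j) \<in> parcs F"
      then show "j = Suc i \<or> i = Suc j" using arcs[of "g i" "g j"] g[of i] g[of j] by simp
    qed
    then show ?thesis by blast
  qed
  have reach: "F.scc_of u = F.scc_of v" if "(u, v) \<in> parcs F" for u v
  proof -
    have "u \<rightarrow>\<^sup>*\<^bsub>with_proj F\<^esub> v" "v \<rightarrow>\<^sup>*\<^bsub>with_proj F\<^esub> u"
      using that F.arcs_symmetric[OF that] F.reachable_adjI[of u v] F.reachable_adjI[of v u] by auto
    then show ?thesis by (auto simp: F.scc_of_def intro: F.reachable_trans)
  qed
  have all: "\<exists>xs. path_enumeration F (\<Union>P) xs" if "finite P" "P \<subseteq> F.sccs_verts" for P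
    using that
  proof (induction P)
    case empty
    then show ?case by (intro exI[of _ "[]"]) (simp add: path_enumeration_def)
  next
    case (insert S P)
    obtain ys where ys: "path_enumeration F (\<Union>P) ys" using insert by auto
    obtain xs where xs: "path_enumeration F S xs" using insert.prems one by auto
    have disj: "S \<inter> T = {}" if "T \<in> P" for T
      using F.sccs_verts_disjoint[of S T] that insert by auto
    have "path_enumeration F (S \<union> \<Union>P) (xs @ ys)"
    proof (rule path_enumeration_append[OF xs ys])
      show "S \<inter> \<Union>P = {}" using disj by blast
      fix a b assume ab: "a \<in> S" "b \<in> \<Union>P"
      then obtain T where T: "T \<in> P" "b \<in> T" by blast
      obtain s t where st: "S = F.scc_of s" "T = F.scc_of t"
        using insert.prems T(1) by (auto simp: F.sccs_verts_conv_scc_of)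
      have "F.scc_of a = S" "F.scc_of b = T"
        using ab T st by (auto simp: F.scc_of_def intro: F.reachable_trans)
      moreover have "S \<noteq> T" using insert.hyps T by blast
      ultimately show "(a, b) \<notin> parcs F \<and> (b, a) \<notin> parcs F" using reach by metis
    qed
    then show ?case by auto
  qed
  have "\<Union>F.sccs_verts = pverts F"
    using F.sccs_verts_subsets F.in_scc_of_self by (auto simp: F.sccs_verts_conv_scc_of)
  then show ?thesis using all[OF F.finite_sccs_verts] by simp
qed

lemma contains_path_graph:
  assumes "pair_graph G" "path_in (\<lambda>x y. (x, y) \<in> parcs G) (pverts G) xs" "length xs = n"
  shows "contains_copy G (path_graph n)"
proof (rule contains_copyI)
  interpret pair_graph G by fact
  show "pair_wf_digraph G" ..
  show "pair_wf_digraph (path_graph n)" using pair_graph_path_graph[of n]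
    by (simp add: pair_graph_def pair_digraph_def pair_fin_digraph_def)
  show "inj_on ((!) xs) (pverts (path_graph n))"
    using assms by (auto simp: path_graph_def path_in_def inj_on_def nth_eq_iff_index_eq)
  show "(!) xs ` pverts (path_graph n) \<subseteq> pverts G"
    using assms by (auto simp: path_graph_def path_in_def subset_iff)
  show "(xs ! u, xs ! v) \<in> parcs G" if "(u, v) \<in> parcs (path_graph n)" for u v
    using that assms arcs_symmetric by (auto simp: path_graph_def path_in_def successively_conv_nth)
qed

text \<open>The centre goes to \<open>v\<close> and the vertex at place \<open>i\<close> of the
  ordering to \<open>xs ! i\<close>; arcs of \<open>F\<close> join neighbouring places and so land
  on edges of the path.\<close>

lemma contains_K1_join:
  assumes G: "pair_graph G" and F: "pair_graph F" and enum: "path_enumeration F (pverts F) fs"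
    and path: "path_in (\<lambda>x y. (x, y) \<in> parcs G) (pverts G) xs" "length xs = card (pverts F)"
    and v: "v \<in> pverts G" "\<And>x. x \<in> set xs \<Longrightarrow> (v, x) \<in> parcs G"
  shows "contains_copy G (K1_join F)"
proof -
  interpret G: pair_graph G by fact
  interpret F: pair_graph F by fact
  have fs: "distinct fs" "set fs = pverts F" using enum by (auto simp: path_enumeration_def)
  have len: "length xs = length fs" using path(2) fs by (simp add: distinct_card[symmetric])
  define idx where "idx = the_inv_into {..<length fs} ((!) fs)"
  have inj: "inj_on ((!) fs) {..<length fs}" using fs by (auto simp: inj_on_def nth_eq_iff_index_eq)
  have img: "(!) fs ` {..<length fs} = pverts F" 
    using nth_image[of "length fs" fs] fs by (simp add: atLeast0LessThan)
  have idx: "idx x < length fs" "fs ! idx x = x" if "x \<in> pverts F" for x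
    using that img f_the_inv_into_f[OF inj, of x] the_inv_into_into[OF inj, of x "{..<length fs}"]
    by (auto simp: idx_def)
  define f where "f = (\<lambda>z. case z of None \<Rightarrow> v | Some x \<Rightarrow> xs ! idx x)"
  have dist: "distinct xs" and xsG: "set xs \<subseteq> pverts G" using path by (auto simp: path_in_def)
  have vxs: "v \<notin> set xs" using v(2) G.no_loops' by blast
  have fxs: "xs ! idx x \<in> set xs" if "x \<in> pverts F" for x using idx[OF that] len by simp
  show ?thesis
  proof (rule contains_copyI[of _ _ f])
    show "pair_wf_digraph G" ..
    show "pair_wf_digraph (K1_join F)" using pair_graph_K1_join[OF F]
      by (simp add: pair_graph_def pair_digraph_def pair_fin_digraph_def)
    have "x = y" if "x \<in> pverts F" "y \<in> pverts F" "xs ! idx x = xs ! idx y" for x y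
      using that idx[of x] idx[of y] dist len by (metis nth_eq_iff_index_eq)
    then show "inj_on f (pverts (K1_join F))"
      using vxs fxs by (auto simp: inj_on_def K1_join_def f_def)
    show "f ` pverts (K1_join F) \<subseteq> pverts G"
      using v(1) fxs xsG by (auto simp: K1_join_def f_def)
  next
    fix a b assume "(a, b) \<in> parcs (K1_join F)"
    then consider x y where "a = Some x" "b = Some y" "(x, y) \<in> parcs F"
      | x where "a = None" "b = Some x" "x \<in> pverts F"
      | x where "a = Some x" "b = None" "x \<in> pverts F"
      by (auto simp: K1_join_def)
    then show "(f a, f b) \<in> parcs G"
    proof cases
      case 1
      then have xy: "x \<in> pverts F" "y \<in> pverts F" using F.in_arcsD1 F.in_arcsD2 by auto
      have "(fs ! idx x, fs ! idx y) \<in> parcs F" using 1 idx xy by simp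
      then have "idx y = Suc (idx x) \<or> idx x = Suc (idx y)"
        using enum idx xy by (auto simp: path_enumeration_def)
      moreover have "(xs ! i, xs ! Suc i) \<in> parcs G" if "Suc i < length fs" for i
        using path(1) that len by (simp add: path_in_def successively_conv_nth)
      ultimately have "(xs ! idx x, xs ! idx y) \<in> parcs G"
        using idx(1)[OF xy(1)] idx(1)[OF xy(2)] G.arcs_symmetric by metis
      then show ?thesis using 1 by (simp add: f_def)
    next
      case 2
      then show ?thesis using v(2) fxs by (simp add: f_def)
    next
      case 3
      then show ?thesis using v(2) fxs G.arcs_symmetric by (simp add: f_def)
    qed
  qed
qed

section \<open>Disjoint cliques as extremal graphs\<close>

text \<open>
  \<open>ramsey_number\<close> is a \<open>LEAST\<close> over graphs of order exactly \<open>r\<close>, so the lower bound needs an extremal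
  graph for every smaller order, not only for the largest one.
\<close>

definition clique_union :: "nat \<Rightarrow> nat \<Rightarrow> nat pair_pre_digraph" where
  "clique_union g r =
    \<lparr> pverts = {..<r}, parcs = {(i, j). i < r \<and> j < r \<and> i \<noteq> j \<and> i mod g = j mod g} \<rparr>"

lemma pair_graph_clique_union: "pair_graph (clique_union g r)"
proof -
  have "parcs (clique_union g r) \<subseteq> {..<r} \<times> {..<r}" by (auto simp: clique_union_def)
  then have "finite (parcs (clique_union g r))" by (rule finite_subset) simp
  then show ?thesis
    by unfold_locales (auto simp: clique_union_def symmetric_def intro: symI)
qed

text \<open>The cliques are the residue classes modulo \<open>g\<close>. A path stays in one class,
  where \<open>div g\<close> separates its vertices but takes at most \<open>n - 1\<close>
  values.\<close>

lemma clique_union_no_path: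
  assumes "1 \<le> n" "r \<le> g * (n - 1)"
  shows "\<not> contains_copy (clique_union g r) (path_graph n)"
proof
  assume "contains_copy (clique_union g r) (path_graph n)"
  then obtain f where inj: "inj_on f (pverts (path_graph n))"
    and f: "f ` pverts (path_graph n) \<subseteq> pverts (clique_union g r)"
    and arcs: "\<And>u v. (u, v) \<in> parcs (path_graph n) \<Longrightarrow> (f u, f v) \<in> parcs (clique_union g r)"
    using contains_copyD by blast
  have inj: "inj_on f {..<n}" and f: "f ` {..<n} \<subseteq> {..<r}"
    using inj f by (simp_all add: path_graph_def clique_union_def)
  have mod: "f i mod g = f 0 mod g" if "i < n" for i
    using that
  proof (induction i)
    case (Suc i)
    then have "(i, Suc i) \<in> parcs (path_graph n)" by (simp add: path_graph_def)
    from arcs[OF this] Suc show ?case by (simp add: clique_union_def)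
  qed simp
  have "inj_on (\<lambda>i. f i div g) {..<n}"
  proof (rule inj_onI)
    fix i j assume ij: "i \<in> {..<n}" "j \<in> {..<n}" "f i div g = f j div g"
    then have "f i mod g = f j mod g" using mod[of i] mod[of j] by simp
    then have "f i = f j" using ij(3) by (metis div_mult_mod_eq)
    then show "i = j" using inj ij(1,2) by (simp add: inj_on_eq_iff)
  qed
  moreover have "(\<lambda>i. f i div g) ` {..<n} \<subseteq> {..<n - 1}"
  proof
    fix x assume "x \<in> (\<lambda>i. f i div g) ` {..<n}"
    then obtain i where i: "i < n" "x = f i div g" by auto
    then have "f i < (n - 1) * g" using f assms(2) by (fastforce simp: mult.commute)
    then show "x \<in> {..<n - 1}" using i less_mult_imp_div_less by simp
  qed
  ultimately have "card {..<n} \<le> card {..<n - 1}" by (intro card_inj_on_le) auto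
  then show False using assms(1) by simp
qed

text \<open>The neighbours of the centre lie outside its residue class. Every class has at least
  \<open>r div g\<close> elements, so at most \<open>r - r div g\<close> vertices remain for
  \<open>F\<close>.\<close>

lemma clique_union_no_join:
  assumes F: "m = card (pverts F)" and g: "1 \<le> g" and r: "r - r div g < m"
  shows "\<not> contains_copy (complement_graph (clique_union g r)) (K1_join F)"
proof
  assume "contains_copy (complement_graph (clique_union g r)) (K1_join F)"
  then obtain f where inj: "inj_on f (pverts (K1_join F))"
    and "f ` pverts (K1_join F) \<subseteq> pverts (complement_graph (clique_union g r))"
    and arcs: "\<And>u v. (u, v) \<in> parcs (K1_join F) \<Longrightarrow>
      (f u, f v) \<in> parcs (complement_graph (clique_union g r))"
    using contains_copyD by blast
  define c where "c = f None mod g"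
  have "f (Some x) < r \<and> f (Some x) mod g \<noteq> c" if "x \<in> pverts F" for x
    using arcs[of None "Some x"] that
    by (auto simp: K1_join_def complement_graph_def clique_union_def c_def)
  then have "(\<lambda>x. f (Some x)) ` pverts F \<subseteq> {j. j < r \<and> j mod g \<noteq> c}" by auto
  moreover have "inj_on (\<lambda>x. f (Some x)) (pverts F)"
    using inj by (auto simp: inj_on_def K1_join_def)
  ultimately have m: "m \<le> card {j. j < r \<and> j mod g \<noteq> c}"
    unfolding F by (intro card_inj_on_le) auto
  have c: "c < g" using g by (simp add: c_def)
  have "(\<lambda>i. c + g * i) ` {..<r div g} \<subseteq> {j. j < r \<and> j mod g = c}"
  proof
    fix j assume "j \<in> (\<lambda>i. c + g * i) ` {..<r div g}"
    then obtain i where i: "i < r div g" "j = c + g * i" by auto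
    have "j < g * Suc i" using c i by simp
    also have "\<dots> \<le> g * (r div g)" using i by (intro mult_le_mono2) simp
    also have "\<dots> \<le> r" by simp
    finally show "j \<in> {j. j < r \<and> j mod g = c}" using i c by simp
  qed
  then have "card {..<r div g} \<le> card {j. j < r \<and> j mod g = c}"
    using g by (intro card_inj_on_le) (auto simp: inj_on_def)
  moreover have "card {j. j < r \<and> j mod g \<noteq> c} + card {j. j < r \<and> j mod g = c} = r"
  proof -
    have "card ({j. j < r \<and> j mod g \<noteq> c} \<union> {j. j < r \<and> j mod g = c}) =
      card {j. j < r \<and> j mod g \<noteq> c} + card {j. j < r \<and> j mod g = c}"
      by (rule card_Un_disjoint) auto
    moreover have "{j. j < r \<and> j mod g \<noteq> c} \<union> {j. j < r \<and> j mod g = c} = {..<r}" by auto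
    ultimately show ?thesis by simp
  qed
  ultimately show False using m r by simp
qed

text \<open>The complement of two cliques is bipartite, whereas the centre and an edge of
  \<open>F\<close> form a triangle.\<close>

lemma two_cliques_no_join:
  assumes F: "pair_graph F" and "parcs F \<noteq> {}"
  shows "\<not> contains_copy (complement_graph (clique_union 2 r)) (K1_join F)"
proof
  interpret F: pair_graph F by fact
  assume "contains_copy (complement_graph (clique_union 2 r)) (K1_join F)"
  then obtain f where "inj_on f (pverts (K1_join F))"
    and "f ` pverts (K1_join F) \<subseteq> pverts (complement_graph (clique_union 2 r))"
    and arcs: "\<And>u v. (u, v) \<in> parcs (K1_join F) \<Longrightarrow>
      (f u, f v) \<in> parcs (complement_graph (clique_union 2 r))"
    using contains_copyD by blast
  obtain x y where xy: "(x, y) \<in> parcs F" using assms(2) by auto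
  then have "x \<in> pverts F" "y \<in> pverts F" using F.in_arcsD1 F.in_arcsD2 by auto
  then have "(f None, f (Some x)) \<in> parcs (complement_graph (clique_union 2 r))"
    "(f None, f (Some y)) \<in> parcs (complement_graph (clique_union 2 r))"
    "(f (Some x), f (Some y)) \<in> parcs (complement_graph (clique_union 2 r))"
    using xy by (auto intro!: arcs simp: K1_join_def)
  then show False
    by (auto simp: complement_graph_def clique_union_def)
qed

lemma ramsey_numberI:
  assumes "\<And>G :: nat pair_pre_digraph. pair_graph G \<Longrightarrow> card (pverts G) = R \<Longrightarrow>
      \<not> contains_copy G G1 \<Longrightarrow> contains_copy (complement_graph G) G2"
    and "\<And>r. r < R \<Longrightarrow> \<exists>g. \<not> contains_copy (clique_union g r) G1 \<and>
      \<not> contains_copy (complement_graph (clique_union g r)) G2"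
  shows "ramsey_number G1 G2 = R"
  unfolding ramsey_number_def
proof (rule Least_equality)
  fix r
  assume r: "\<forall>G :: nat pair_pre_digraph. pair_graph G \<and> card (pverts G) = r \<longrightarrow>
    contains_copy G G1 \<or> contains_copy (complement_graph G) G2"
  show "R \<le> r"
  proof (rule ccontr)
    assume "\<not> R \<le> r"
    then obtain g where "\<not> contains_copy (clique_union g r) G1"
      "\<not> contains_copy (complement_graph (clique_union g r)) G2"
      using assms(2)[of r] by auto
    moreover have "card (pverts (clique_union g r)) = r" by (simp add: clique_union_def)
    ultimately show False using r pair_graph_clique_union by blast
  qed
qed (use assms(1) in blast)

lemma complement_contains_K1_join:
  fixes G :: "'b pair_pre_digraph" and E :: "'b \<Rightarrow> 'b \<Rightarrow> bool"
  defines "E \<equiv> \<lambda>x y. (x, y) \<in> parcs G"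
  assumes G: "pair_graph G" and F: "linear_forest F"
    and v: "v \<in> pverts G" and path: "path_in (co E) (pverts G) xs" "card (pverts F) \<le> length xs"
    and vxs: "\<And>x. x \<in> set xs \<Longrightarrow> co E v x"
  shows "contains_copy (complement_graph G) (K1_join F)"
proof -
  have pg: "pair_graph F" using F by (simp add: linear_forest_def undirected_forest_def)
  obtain fs where fs: "path_enumeration F (pverts F) fs" using linear_forest_enumeration[OF F] by blast
  \<comment> \<open>The path may be longer than \<open>F\<close>: in the range m <= n it has
    \<open>n\<close> vertices.\<close>
  let ?xs = "take (card (pverts F)) xs"
  have len: "length ?xs = card (pverts F)" using path(2) by simp
  have arc: "(x, y) \<in> parcs (complement_graph G)" if "x \<in> pverts G" "y \<in> pverts G" "co E x y" for x y
    using that by (simp add: complement_graph_def co_def E_def)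
  have xsG: "set xs \<subseteq> pverts G" using path(1) by (simp add: path_in_def)
  have verts: "pverts (complement_graph G) = pverts G" by (simp add: complement_graph_def)
  have "path_in (co E) (pverts G) ?xs" using path(1) by (rule path_in_take)
  then have "path_in (\<lambda>x y. (x, y) \<in> parcs (complement_graph G)) (pverts G) ?xs"
    using arc by (auto simp: path_in_def elim!: successively_mono)
  then show ?thesis
    using contains_K1_join[OF pair_graph_complement_graph[OF G] pg fs _ len, of v] v vxs arc xsG verts
    by (metis in_set_takeD subsetD)
qed

lemma finite_path_free_pair_graph:
  assumes "pair_graph G" "\<not> contains_copy G (path_graph n)" "2 \<le> n"
  shows "finite_path_free (\<lambda>x y. (x, y) \<in> parcs G) (pverts G) n"
proof -
  interpret pair_graph G by fact
  show ?thesis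
    by unfold_locales
      (use assms contains_path_graph pair_finite_verts arcs_symmetric no_loops' in_arcsD1 in_arcsD2 in blast)+
qed

section \<open>Arithmetic of the bound\<close>

text \<open>When \<open>r\<close> grows by one, \<open>r div g\<close> grows by at most one. This
  passes a bound from the largest order to all smaller ones.\<close>

lemma diff_div_mono:
  fixes r s g :: nat
  assumes "r \<le> s" "1 \<le> g"
  shows "r - r div g \<le> s - s div g"
proof -
  have step: "a - a div g \<le> Suc a - Suc a div g" for a :: nat
    by (auto simp: div_Suc Suc_diff_le)
  from assms(1) show ?thesis
    by (induction rule: dec_induct) (use step le_trans in blast)+
qed

lemma t_beta_bounds:
  assumes "2 \<le> n" "2 \<le> m"
  shows "m - 1 \<le> t_beta n m * (n - 1)" "(t_beta n m - 1) * (n - 1) < m - 1" "1 \<le> t_beta n m"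
proof -
  define a where "a = t_alpha n m"
  have n1: "real (n - 1) > 0" and m1: "real (m - 1) > 0" using assms by auto
  have a: "a = real (m - 1) / real (n - 1)" using assms by (simp add: a_def t_alpha_def of_nat_diff)
  then have apos: "a > 0" using n1 m1 by simp
  have b: "real (t_beta n m) = of_int \<lceil>a\<rceil>" using apos by (simp add: t_beta_def a_def)
  have "a \<le> real (t_beta n m)" "real (t_beta n m) < a + 1" using b by linarith+
  moreover have an: "a * real (n - 1) = real (m - 1)" using a n1 by simp
  ultimately have le: "real (m - 1) \<le> real (t_beta n m) * real (n - 1)"
    and lt: "(real (t_beta n m) - 1) * real (n - 1) < real (m - 1)"
    using n1 by (metis mult_right_mono less_imp_le)
      (use an n1 \<open>real (t_beta n m) < a + 1\<close> in \<open>metis diff_less_eq mult_strict_right_mono\<close>)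
  show b1: "1 \<le> t_beta n m" using apos b by linarith
  show "m - 1 \<le> t_beta n m * (n - 1)" using le by (simp flip: of_nat_mult)
  have "real (t_beta n m - 1) * real (n - 1) < real (m - 1)" using lt b1 by (simp add: of_nat_diff)
  then show "(t_beta n m - 1) * (n - 1) < m - 1" by (simp flip: of_nat_mult)
qed

lemma t_value_eq:
  assumes "2 \<le> n" "2 \<le> m"
  defines "b \<equiv> t_beta n m"
  shows "t_value n m =
    (if (m - 1) * (b + 1) \<le> (n - 1) * b * b then (n - 1) * b + 1 else (m - 1) div b + m)"
proof -
  have n1: "real (n - 1) > 0" using assms(1) by simp
  have "t_alpha n m \<le> t_gamma n m \<longleftrightarrow> real (m - 1) / real (n - 1) \<le> (real b)\<^sup>2 / real (b + 1)"
    using assms by (simp add: t_alpha_def t_gamma_def of_nat_diff add.commute)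
  also have "\<dots> \<longleftrightarrow> real (m - 1) * real (b + 1) \<le> (real b)\<^sup>2 * real (n - 1)"
    using n1 by (simp add: divide_le_eq le_divide_eq field_simps)
  also have "\<dots> \<longleftrightarrow> (m - 1) * (b + 1) \<le> (n - 1) * b * b"
  proof -
    have "real (m - 1) * real (b + 1) = real ((m - 1) * (b + 1))" by (rule of_nat_mult[symmetric])
    moreover have "(real b)\<^sup>2 * real (n - 1) = real ((n - 1) * b * b)"
      by (simp only: power2_eq_square of_nat_mult mult_ac)
    ultimately show ?thesis by (simp only: of_nat_le_iff)
  qed
  finally have "t_alpha n m \<le> t_gamma n m \<longleftrightarrow> (m - 1) * (b + 1) \<le> (n - 1) * b * b" .
  moreover have "nat \<lfloor>(real m - 1) / real b\<rfloor> = (m - 1) div b"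
  proof -
    have "real m - 1 = real (m - 1)" using assms(2) by (simp add: of_nat_diff)
    then show ?thesis by (simp only: floor_divide_of_nat_eq nat_int)
  qed
  ultimately show ?thesis by (simp only: t_value_def b_def)
qed

text \<open>The first two inequalities are those of the component count, and
  \<open>t_value n m\<close> is the least integer that satisfies both. The third leaves
  \<open>m\<close> vertices when at most \<open>n div 2\<close> are deleted.\<close>

lemma t_value_upper:
  assumes n: "2 \<le> n" and m: "2 * n \<le> m"
  defines "b \<equiv> t_beta n m"
  shows "(n - 1) * b < t_value n m" "(b + 1) * (m - 1) < b * t_value n m"
    "m + n div 2 \<le> t_value n m"
proof -
  have m2: "2 \<le> m" using n m by simp
  note b = t_beta_bounds[OF n m2, folded b_def]
  define t where "t = t_value n m"
  have t: "t = (if (m - 1) * (b + 1) \<le> (n - 1) * b * b then (n - 1) * b + 1 else (m - 1) div b + m)"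
    unfolding t_def b_def by (rule t_value_eq[OF n m2])
  have "(n - 1) * b < t \<and> (b + 1) * (m - 1) < b * t"
  proof (cases "(m - 1) * (b + 1) \<le> (n - 1) * b * b")
    case True
    then have "b * t = (n - 1) * b * b + b" by (simp add: t algebra_simps)
    then show ?thesis using True b(3) t by (simp add: mult.commute)
  next
    case False
    have "m - 1 < b * ((m - 1) div b) + b"
      using b(3) by (metis add_less_cancel_left mod_less_divisor mult_div_mod_eq less_le_trans zero_less_one)
    moreover have "t = (m - 1) div b + m" using False by (simp only: t if_False)
    then have "b * t = b * ((m - 1) div b) + b * (m - 1) + b"
      using m2 by (cases m) (auto simp: algebra_simps)
    ultimately have *: "(b + 1) * (m - 1) < b * t" by (simp add: algebra_simps)
    then have "b * ((n - 1) * b) < b * t" using False by (simp add: algebra_simps)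
    then show ?thesis using * by simp
  qed
  then show 1: "(n - 1) * b < t_value n m" and 2: "(b + 1) * (m - 1) < b * t_value n m"
    by (simp_all add: t_def)
  \<comment> \<open>A violation would give 2m <= bn, which is incompatible with (b - 1)(n - 1) < m -
    1 and m >= 2n.\<close>
  show "m + n div 2 \<le> t_value n m"
  proof (rule ccontr)
    assume "\<not> ?thesis"
    then have "t + 1 \<le> m + n div 2" by (simp add: t_def)
    then have "b * (t + 1) \<le> b * (m + n div 2)" by (rule mult_le_mono2)
    then have "(b + 1) * (m - 1) + 1 + b \<le> b * m + b * (n div 2)"
      using 2 by (simp add: t_def algebra_simps)
    moreover obtain p where p: "m = Suc p" using m2 by (cases m) auto
    ultimately have "m \<le> b * (n div 2)" by (simp add: algebra_simps)
    moreover have "b * (2 * (n div 2)) \<le> b * n" by (intro mult_le_mono2) simp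
    then have "2 * (b * (n div 2)) \<le> b * n" by (simp only: mult.left_commute[of b 2])
    ultimately have m_le: "2 * m \<le> b * n" by linarith
    \<comment> \<open>The shifts n = q + 2, b = c + 1 and m = p + 1 remove all subtractions.\<close>
    obtain q where q: "n = Suc (Suc q)" using n by (metis Suc_diff_le add_2_eq_Suc le_Suc_ex)
    obtain c where c: "b = Suc c" using b(3) by (cases b) auto
    have "c * Suc q < p" using b(2) by (simp add: p q c)
    then have "c + c * q < p" by simp
    moreover have "2 * p + 2 \<le> 2 + q + 2 * c + c * q" using m_le by (simp add: p q c algebra_simps)
    ultimately have cp: "p \<le> q + c" by linarith
    have "2 * q + 3 \<le> p" using m p q by simp
    then have "q + 3 \<le> c" using cp by linarith
    then have "3 * q \<le> c * q" by (intro mult_right_mono) auto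
    then show False using \<open>c + c * q < p\<close> cp by linarith
  qed
qed

text \<open>The number of cliques is \<beta> if \<alpha> \<le> \<gamma> and \<beta> + 1 otherwise;
  the bound on \<open>r - r div g\<close> is checked at the largest order and passed down by
  monotonicity.\<close>

lemma t_value_lower:
  assumes n: "2 \<le> n" and m: "2 \<le> m" and r: "r < t_value n m"
  shows "\<exists>g. 1 \<le> g \<and> r \<le> g * (n - 1) \<and> r - r div g < m"
proof -
  define b where "b = t_beta n m"
  note b = t_beta_bounds[OF n m, folded b_def]
  show ?thesis
  proof (cases "(m - 1) * (b + 1) \<le> (n - 1) * b * b")
    case True
    then have le: "r \<le> b * (n - 1)" using r t_value_eq[OF n m] by (simp add: b_def mult.commute)
    have "r - r div b \<le> b * (n - 1) - b * (n - 1) div b" using le b(3) by (rule diff_div_mono)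
    also have "\<dots> = (b - 1) * (n - 1)" using b(3) by (simp add: diff_mult_distrib)
    finally show ?thesis using le b(2,3) by (intro exI[of _ b]) auto
  next
    case False
    define q where "q = (m - 1) div b"
    have r': "r \<le> q + (m - 1)" using False r m t_value_eq[OF n m] by (simp add: b_def q_def)
    have bq: "b * q \<le> m - 1" by (simp add: q_def)
    then have "b * q \<le> b * (n - 1)" using b(1) by linarith
    then have "q \<le> n - 1" using b(3) by simp
    then have "r \<le> (b + 1) * (n - 1)" using r' b(1) by simp
    \<comment> \<open>Each clique of the largest graph has at least \<open>q\<close> vertices, so at
      most \<open>m - 1\<close> lie outside it.\<close>
    moreover have "q * (b + 1) \<le> q + (m - 1)" using bq by (simp add: algebra_simps)
    then have "q \<le> (q + (m - 1)) div (b + 1)" by (simp add: less_eq_div_iff_mult_less_eq)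
    then have "r - r div (b + 1) < m"
      using diff_div_mono[OF r', of "b + 1"] m by linarith
    ultimately show ?thesis by (intro exI[of _ "b + 1"]) auto
  qed
qed

theorem theorem3:
  fixes n m :: nat and F :: "'a pair_pre_digraph"
  assumes "n \<ge> 2"
    and "linear_forest F" and "parcs F \<noteq> {}"
    and "card (pverts F) = m"
  shows "(2 \<le> m \<and> m \<le> n \<longrightarrow> ramsey_number (path_graph n) (K1_join F) = 2 * n - 1)
       \<and> (m \<ge> 2 * n \<longrightarrow> ramsey_number (path_graph n) (K1_join F) = t_value n m)"
proof (intro conjI impI)
  have F: "pair_graph F" using assms(2) by (simp add: linear_forest_def undirected_forest_def)
  {
    assume m: "2 \<le> m \<and> m \<le> n"
    show "ramsey_number (path_graph n) (K1_join F) = 2 * n - 1"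
    proof (rule ramsey_numberI)
      fix G :: "nat pair_pre_digraph"
      assume G: "pair_graph G" "card (pverts G) = 2 * n - 1" "\<not> contains_copy G (path_graph n)"
      interpret finite_path_free "\<lambda>x y. (x, y) \<in> parcs G" "pverts G" n
        using finite_path_free_pair_graph G assms(1) by blast
      show "contains_copy (complement_graph G) (K1_join F)"
        using join_path_small[OF G(2)] complement_contains_K1_join[OF G(1) assms(2)] m assms(4)
        by blast
    next
      fix r assume "r < 2 * n - 1"
      then have "r \<le> 2 * (n - 1)" by simp
      then show "\<exists>g. \<not> contains_copy (clique_union g r) (path_graph n) \<and>
          \<not> contains_copy (complement_graph (clique_union g r)) (K1_join F)"
        using clique_union_no_path[of n r 2] two_cliques_no_join[OF F assms(3)] assms(1) by auto
    qed
  next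
    assume m: "2 * n \<le> m"
    show "ramsey_number (path_graph n) (K1_join F) = t_value n m"
    proof (rule ramsey_numberI)
      fix G :: "nat pair_pre_digraph"
      assume G: "pair_graph G" "card (pverts G) = t_value n m" "\<not> contains_copy G (path_graph n)"
      interpret finite_path_free "\<lambda>x y. (x, y) \<in> parcs G" "pverts G" n
        using finite_path_free_pair_graph G assms(1) by blast
      show "contains_copy (complement_graph G) (K1_join F)"
        using join_path_large[OF m, of "t_beta n m"] t_value_upper[OF assms(1) m] G(2)
          complement_contains_K1_join[OF G(1) assms(2)] assms(4)
        by (metis order_refl)
    next
      fix r assume r: "r < t_value n m"
      have "2 \<le> m" using m assms(1) by simp
      then obtain g where "1 \<le> g" "r \<le> g * (n - 1)" "r - r div g < m"
        using t_value_lower[OF assms(1) _ r] by blast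
      then show "\<exists>g. \<not> contains_copy (clique_union g r) (path_graph n) \<and>
          \<not> contains_copy (complement_graph (clique_union g r)) (K1_join F)"
        using clique_union_no_path[of n r g] clique_union_no_join[of m F g r] assms(1,4) by auto
    qed
  }
qed

end
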